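(* Let $d\ge2$ and $s>d/2$. There is a constant $b(s,d)>0$ (depending on the chosen $\mathbb{H}^s(\mathbb{S}^d)$-norm but not on $N$) such that for every $N\ge1$, if $\mathbf{x}_1,\dots,\mathbf{x}_N$ are independently and uniformly distributed on $\mathbb{S}^d$, then $$\sqrt{\mathbb{E}\Bigg[\sup_{f\in\mathbb{H}^s(\mathbb{S}^d),\ \|f\|_{\mathbb{H}^s}\le1}\Big|\frac1N\sum_{j=1}^Nf(\mathbf{x}_j)-\int_{\mathbb{S}^d}f(\mathbf{x})\,\mathrm{d}\sigma_d(\mathbf{x})\Big|^2\Bigg]}=\frac{b(s,d)}{N^{1/2}}.$$
   Context: $\mathbb{S}^d$ is the unit sphere in $\mathbb{R}^{d+1}$, $d\ge 2$, and $\sigma_d$ is its normalized surface measure ($\sigma_d(\mathbb{S}^d)=1$); "uniformly distributed" means with law $\sigma_d$. Let $\{Y_{\ell,k}:k=1,\dots,Z(d,\ell)\}$ be an $\mathbb{L}_2(\mathbb{S}^d,\sigma_d)$-orthonormal family of real spherical harmonics of exact degree $\ell$, where $Z(d,\ell)=(2\ell+d-1)\frac{\Gamma(\ell+d-1)}{\Gamma(d)\Gamma(\ell+1)}$, and let $\lambda_\ell=\ell(\ell+d-1)$, $\ell\ge 0$. For $f\in \mathbb{L}_2(\mathbb{S}^d)$ put $\widehat f_{\ell,k}=\int_{\mathbb{S}^d} f\,Y_{\ell,k}\,\mathrm{d}\sigma_d$. For $s>d/2$ the Sobolev space $\mathbb{H}^s(\mathbb{S}^d)$ is the set of $f\in \mathbb{L}_2(\mathbb{S}^d)$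 with $\sum_{\ell=0}^\infty\sum_{k=1}^{Z(d,\ell)}(1+\lambda_\ell)^s|\widehat f_{\ell,k}|^2<\infty$ (embedded in $C(\mathbb{S}^d)$), with norm $\|f\|_{\mathbb{H}^s}=\big[\sum_{\ell=0}^\infty\sum_{k=1}^{Z(d,\ell)}\frac{1}{a_\ell^{(s)}}|\widehat f_{\ell,k}|^2\big]^{1/2}$, where $(a_\ell^{(s)})_{\ell\ge0}$ is a fixed sequence of positive reals with $a_\ell^{(s)}\asymp(1+\lambda_\ell)^{-s}$. Here $a_n\asymp b_n$ means $c_1a_n\le b_n\le c_2a_n$ for all $n$ with positive constants $c_1,c_2$ independent of $n$. *)

theory Defs
  imports "HOL-Probability.Probability"
begin

text \<open>
  The normalized surface measure \<open>\<sigma>\<^sub>d\<close> as the angular part of the polar decomposition of Lebesgue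
  measure: the image of the uniform distribution on the unit ball under \<open>x \<mapsto> x / \<parallel>x\<parallel>\<close>.
  The outer restriction makes the sphere itself the underlying space; the origin, which is sent to
  \<open>0\<close>, is a null set.
\<close>

definition sphere_measure :: "(real ^ 'n) measure" where
  "sphere_measure =
     restrict_space
       (distr (uniform_measure lborel (ball 0 1)) borel (\<lambda>x. x /\<^sub>R norm x))
       (sphere 0 1)"

definition laplacian :: "(real ^ 'n \<Rightarrow> real) \<Rightarrow> real ^ 'n \<Rightarrow> real" where
  "laplacian p x = (\<Sum>i\<in>UNIV. (deriv ^^ 2) (\<lambda>t. p (x + t *\<^sub>R axis i 1)) 0)"

text \<open>Only the values of \<open>Y\<close> on the unit sphere matter, here and below.\<close>

definition spherical_harmonic :: "nat \<Rightarrow> (real ^ 'n \<Rightarrow> real) \<Rightarrow> bool" where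
  "spherical_harmonic l Y \<longleftrightarrow>
     (\<exists>p. real_polynomial_function p \<and>
          (\<forall>c x. p (c *\<^sub>R x) = c ^ l * p x) \<and>
          (\<forall>x. laplacian p x = 0) \<and>
          (\<forall>x\<in>sphere 0 1. Y x = p x))"

text \<open>The quotient below is a natural number, see \<open>real_harmonic_dim\<close>.\<close>

definition harmonic_dim :: "nat \<Rightarrow> nat \<Rightarrow> nat" where
  "harmonic_dim d l =
     nat \<lfloor>(2 * real l + real d - 1) * Gamma (real l + real d - 1)
            / (Gamma (real d) * Gamma (real l + 1))\<rfloor>"

definition lb_eigenvalue :: "nat \<Rightarrow> nat \<Rightarrow> real" where
  "lb_eigenvalue d l = real l * (real l + real d - 1)"

definition orthonormal_harmonics :: "nat \<Rightarrow> (nat \<Rightarrow> nat \<Rightarrow> real ^ 'n \<Rightarrow> real) \<Rightarrow> bool" where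
  "orthonormal_harmonics d Y \<longleftrightarrow>
     (\<forall>l. (\<forall>k\<in>{1..harmonic_dim d l}. spherical_harmonic l (Y l k)) \<and>
          (\<forall>k\<in>{1..harmonic_dim d l}. \<forall>k'\<in>{1..harmonic_dim d l}.
             (LINT x|sphere_measure. Y l k x * Y l k' x) = (if k = k' then 1 else 0)))"

definition sphere_L2 :: "(real ^ 'n \<Rightarrow> real) set" where
  "sphere_L2 = {f \<in> borel_measurable sphere_measure. integrable sphere_measure (\<lambda>x. (f x)\<^sup>2)}"

definition fourier_coeff ::
    "(nat \<Rightarrow> nat \<Rightarrow> real ^ 'n \<Rightarrow> real) \<Rightarrow> (real ^ 'n \<Rightarrow> real) \<Rightarrow> nat \<Rightarrow> nat \<Rightarrow> real" where
  "fourier_coeff Y f l k = (LINT x|sphere_measure. f x * Y l k x)"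

text \<open>
  For \<open>s > d/2\<close> every class in the Sobolev space has a unique continuous representative on the sphere.
  Since point evaluations are needed, the space is represented by these continuous functions.
\<close>

definition sobolev_space ::
    "nat \<Rightarrow> real \<Rightarrow> (nat \<Rightarrow> nat \<Rightarrow> real ^ 'n \<Rightarrow> real) \<Rightarrow> (real ^ 'n \<Rightarrow> real) set" where
  "sobolev_space d s Y =
     {f \<in> sphere_L2. continuous_on (sphere 0 1) f \<and>
        summable (\<lambda>l. \<Sum>k=1..harmonic_dim d l.
                    (1 + lb_eigenvalue d l) powr s * \<bar>fourier_coeff Y f l k\<bar>\<^sup>2)}"

definition sobolev_norm ::
    "nat \<Rightarrow> (nat \<Rightarrow> real) \<Rightarrow> (nat \<Rightarrow> nat \<Rightarrow> real ^ 'n \<Rightarrow> real) \<Rightarrow> (real ^ 'n \<Rightarrow> real) \<Rightarrow> real" where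
  "sobolev_norm d a Y f =
     sqrt (\<Sum>l. \<Sum>k=1..harmonic_dim d l. 1 / a l * \<bar>fourier_coeff Y f l k\<bar>\<^sup>2)"

definition same_order :: "(nat \<Rightarrow> real) \<Rightarrow> (nat \<Rightarrow> real) \<Rightarrow> bool" where
  "same_order a b \<longleftrightarrow>
     (\<exists>c1>0. \<exists>c2>0. \<forall>n. c1 * a n \<le> b n \<and> b n \<le> c2 * a n)"

definition sup_sq_error ::
    "nat \<Rightarrow> real \<Rightarrow> (nat \<Rightarrow> real) \<Rightarrow> (nat \<Rightarrow> nat \<Rightarrow> real ^ 'n \<Rightarrow> real) \<Rightarrow>
       nat \<Rightarrow> (nat \<Rightarrow> real ^ 'n) \<Rightarrow> real" where
  "sup_sq_error d s a Y N x =
     (SUP f\<in>{f \<in> sobolev_space d s Y. sobolev_norm d a Y f \<le> 1}.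
        \<bar>1 / real N * (\<Sum>j=1..N. f (x j)) - (LINT y|sphere_measure. f y)\<bar>\<^sup>2)"


lemma space_sphere_measure [simp]: "space (sphere_measure :: (real ^ 'n) measure) = sphere 0 1"
  by (simp add: sphere_measure_def space_restrict_space)

lemma sets_sphere_measure:
  "A \<in> sets (sphere_measure :: (real ^ 'n) measure) \<longleftrightarrow> A \<subseteq> sphere 0 1 \<and> A \<in> sets borel"
  unfolding sphere_measure_def by (subst sets_restrict_space_iff) auto

definition open_cone :: "(real ^ 'n) set \<Rightarrow> (real ^ 'n) set" where
  "open_cone A = {t *\<^sub>R y | t y. 0 < t \<and> t < 1 \<and> y \<in> A}"

lemma open_cone_eq:
  fixes A :: "(real ^ 'n) set"
  assumes "A \<subseteq> sphere 0 1"
  shows "open_cone A = ball 0 1 \<inter> (\<lambda>x. x /\<^sub>R norm x) -` A"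
proof (intro set_eqI iffI)
  fix x assume x: "x \<in> ball 0 1 \<inter> (\<lambda>x. x /\<^sub>R norm x) -` A"
  then have "x \<noteq> 0" using assms by auto
  then have "x = norm x *\<^sub>R (x /\<^sub>R norm x)" "0 < norm x" "norm x < 1" "x /\<^sub>R norm x \<in> A"
    using x by auto
  then show "x \<in> open_cone A" unfolding open_cone_def by blast
next
  fix x assume "x \<in> open_cone A"
  then obtain t y where "x = t *\<^sub>R y" "0 < t" "t < 1" "y \<in> A" unfolding open_cone_def by blast
  moreover then have "norm y = 1" using assms by auto
  ultimately show "x \<in> ball 0 1 \<inter> (\<lambda>x. x /\<^sub>R norm x) -` A" by auto
qed

lemma open_cone_borel:
  fixes A :: "(real ^ 'n) set"
  assumes "A \<subseteq> sphere 0 1" "A \<in> sets borel"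
  shows "open_cone A \<in> sets borel"
proof -
  have "(\<lambda>x::real^'n. x /\<^sub>R norm x) \<in> borel_measurable borel" by measurable
  from measurable_sets[OF this assms(2)] show ?thesis by (auto simp: open_cone_eq[OF assms(1)])
qed

lemma emeasure_sphere_measure:
  fixes A :: "(real ^ 'n) set"
  assumes "A \<subseteq> sphere 0 1" "A \<in> sets borel"
  shows "emeasure sphere_measure A =
           emeasure lborel (open_cone A) / emeasure lborel (ball 0 1 :: (real ^ 'n) set)"
proof -
  let ?f = "\<lambda>x::real^'n. x /\<^sub>R norm x"
  have m: "?f \<in> borel_measurable borel" by measurable
  have "emeasure sphere_measure A =
      emeasure (distr (uniform_measure lborel (ball 0 1)) borel ?f) A"
    unfolding sphere_measure_def using assms by (subst emeasure_restrict_space) auto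
  also have "\<dots> = emeasure (uniform_measure lborel (ball 0 1)) (?f -` A)"
    using assms m by (subst emeasure_distr) (auto cong: measurable_cong_sets)
  also have "\<dots> = emeasure lborel (ball 0 1 \<inter> ?f -` A) / emeasure lborel (ball 0 1 :: (real ^ 'n) set)"
    using measurable_sets[OF m assms(2)] by (subst emeasure_uniform_measure) auto
  finally show ?thesis by (simp add: open_cone_eq[OF assms(1)])
qed

lemma prob_space_sphere_measure: "prob_space (sphere_measure :: (real ^ 'n) measure)"
proof
  have e: "open_cone (sphere 0 1) = ball 0 1 - {0 :: real ^ 'n}"
    by (subst open_cone_eq) auto
  have "emeasure lborel (ball 0 1 - {0 :: real ^ 'n}) = emeasure lborel (ball 0 1 :: (real ^ 'n) set)"
    by (subst emeasure_Diff) auto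
  moreover have "emeasure lborel (ball 0 1 :: (real ^ 'n) set) \<noteq> 0"
    using content_ball_pos[of 1 "0 :: real ^ 'n"] by (auto simp: measure_def)
  ultimately show "emeasure (sphere_measure :: (real ^ 'n) measure)
      (space (sphere_measure :: (real ^ 'n) measure)) = 1"
    using emeasure_lborel_ball_finite[of "0 :: real ^ 'n" 1]
    by (simp add: emeasure_sphere_measure e)
qed

lemma real_harmonic_dim:
  assumes "d \<ge> 2"
  shows "real (harmonic_dim d l) =
           (2 * real l + real d - 1) * Gamma (real l + real d - 1)
             / (Gamma (real d) * Gamma (real l + 1))"
proof -
  obtain e where d: "d = Suc (Suc e)"
    using assms by (metis Suc_le_D numeral_2_eq_2 Suc_le_mono)
  let ?Z = "((l + Suc e) choose (Suc e)) + (if l = 0 then 0 else (l + e) choose (Suc e))"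
  have "(2 * real l + real d - 1) * Gamma (real l + real d - 1)
          / (Gamma (real d) * Gamma (real l + 1)) =
        (2 * real l + real e + 1) * fact (l + e) / (fact (Suc e) * fact l)"
    using Gamma_fact[of "l + e", where 'a = real] Gamma_fact[of l, where 'a = real]
      Gamma_fact[of "Suc e", where 'a = real]
    by (simp add: d algebra_simps)
  also have "\<dots> = real ?Z"
  proof (cases l)
    case 0
    then show ?thesis using fact_nonzero[of "Suc e", where ?'a = real] by (simp del: fact_Suc) (simp add: field_simps)
  next
    case (Suc m)
    have 1: "real ((l + Suc e) choose (Suc e)) = fact (l + Suc e) / (fact (Suc e) * fact l)"
      by (subst binomial_fact) auto
    have 2: "real ((l + e) choose (Suc e)) = fact (l + e) / (fact (Suc e) * fact m)"
      using Suc by (subst binomial_fact) auto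
    have 3: "fact l = real l * fact m" using Suc by simp
    have 4: "fact (l + Suc e) = (real l + real e + 1) * (fact (l + e) :: real)"
      by (simp add: algebra_simps)
    have 5: "fact (l + e) / (fact (Suc e) * fact m) =
        real l * fact (l + e) / (fact (Suc e) * fact l)"
      unfolding 3 using Suc by (simp del: fact_Suc)
    have "real ?Z = fact (l + Suc e) / (fact (Suc e) * fact l)
            + fact (l + e) / (fact (Suc e) * fact m)"
      unfolding of_nat_add 1 using Suc 2 by (simp del: fact_Suc binomial_Suc_Suc)
    also have "\<dots> = ((real l + real e + 1) * fact (l + e) + real l * fact (l + e))
            / (fact (Suc e) * fact l)"
      unfolding 4 5 by (simp only: add_divide_distrib)
    also have "(real l + real e + 1) * fact (l + e) + real l * fact (l + e) =
        (2 * real l + real e + 1) * fact (l + e)"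
      by (simp only: distrib_right[symmetric]) simp
    finally show ?thesis by simp
  qed
  finally have "(2 * real l + real d - 1) * Gamma (real l + real d - 1)
          / (Gamma (real d) * Gamma (real l + 1)) = real ?Z" .
  then show ?thesis unfolding harmonic_dim_def by (metis floor_of_nat nat_int)
qed

end

theory Submission
  imports Defs "HOL-Library.Function_Algebras"
begin

text \<open>
  The worst-case error over the Sobolev unit ball is an explicit quadratic expression in the
  nodes, and its expectation is then computed term by term.

  Every \<open>f\<close> in the Sobolev space equals its harmonic series \<open>\<Sum>l k. c l k * Y l k\<close> at every point
  of the sphere (\<open>sobolev_expansion\<close>). The term \<open>l = 0\<close> is the mean of \<open>f\<close>, so the quadrature
  error of \<open>f\<close> is the sum over \<open>l \<ge> 1\<close> of \<open>c l k * m l k\<close>, where \<open>m l k\<close> is the average of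
  \<open>Y l k\<close> over the nodes. By Cauchy-Schwarz its square is at most
  \<open>T = \<Sum>l\<ge>1. a l * (\<Sum>k. (m l k)\<^sup>2)\<close> when the norm of \<open>f\<close> is at most \<open>1\<close>, and the function with
  coefficients \<open>a l * m l k / sqrt T\<close> attains this value (\<open>sup_sq_error_eq\<close>). For \<open>l \<ge> 1\<close> the
  random variables \<open>Y l k (X j)\<close> are pairwise uncorrelated with mean \<open>0\<close> and variance \<open>1\<close>, so
  \<open>m l k\<close> has second moment \<open>1 / N\<close>. Hence the expectation of \<open>T\<close> is \<open>b\<^sup>2 / N\<close> with
  \<open>b\<^sup>2 = \<Sum>l\<ge>1. a l * harmonic_dim d l\<close>; this converges since \<open>harmonic_dim d l\<close> grows like
  \<open>l ^ (d - 1)\<close> and \<open>a l\<close> decays like \<open>l powr (- 2 * s)\<close> with \<open>2 * s > d\<close> (\<open>summable_trace\<close>).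

  Three facts on spherical harmonics carry this argument.

  First, harmonics of different degrees are orthogonal (\<open>harmonic_orthogonal_degrees\<close>). With the
  weight \<open>u = max 0 (1 - |x|\<^sup>2)\<close>, the integral over space of the divergence of
  \<open>u\<^sup>2 * (p * grad q - q * grad p)\<close> vanishes. By harmonicity and the Euler identity this
  divergence is a multiple of \<open>u * p * q\<close>, and the integral of \<open>u * p * q\<close> over space is a
  positive multiple of the integral of \<open>p * q\<close> over the sphere (\<open>integral_weight_hom_polys\<close>).

  Second, the given functions of degree at most \<open>l\<close> form a basis of the polynomials of degree at
  most \<open>l\<close> on the sphere (\<open>sphere_polys_expansion\<close>). Since \<open>|x|\<^sup>2 = 1\<close> there, these polynomials
  are spanned by the monomials of degrees \<open>l\<close> and \<open>l - 1\<close>, and there are at most as many of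
  these as there are orthonormal functions. By Stone-Weierstrass the whole system is complete
  (\<open>completeness\<close>).

  Third, the squares of the functions of degree \<open>l\<close> add up to the constant \<open>harmonic_dim d l\<close>
  (\<open>addition_formula\<close>). The polynomials of degree at most \<open>l\<close> on the sphere form a space
  invariant under rotations, and the surface measure is rotation invariant as well, so the
  diagonal of the reproducing kernel of this space is constant. This pointwise bound is what
  makes the harmonic series converge uniformly.
\<close>

section \<open>Homogeneous polynomials\<close>

text \<open>
  Linear algebra in spaces of real functions: spans, independence and the exchange lemma.
\<close>

interpretation fun_space: vector_space "\<lambda>(c::real) (f::'a\<Rightarrow>real) x. c * f x"
  by unfold_locales (auto simp: algebra_simps fun_eq_iff)

definition monomial :: "('n::finite \<Rightarrow> nat) \<Rightarrow> real ^ 'n \<Rightarrow> real" where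
  "monomial \<alpha> x = (\<Prod>i\<in>UNIV. x $ i ^ \<alpha> i)"

definition hom_polys :: "nat \<Rightarrow> (real ^ 'n::finite \<Rightarrow> real) set" where
  "hom_polys l = fun_space.span (monomial ` {\<alpha>. sum \<alpha> UNIV = l})"

lemma hom_polys_zero: "(\<lambda>x. 0) \<in> hom_polys l"
  using fun_space.span_zero unfolding hom_polys_def by (simp add: zero_fun_def)

lemma hom_polys_add:
  assumes "p \<in> hom_polys l" "q \<in> hom_polys l"
  shows "(\<lambda>x. p x + q x) \<in> hom_polys l"
  using fun_space.span_add[OF assms[unfolded hom_polys_def]]
  unfolding hom_polys_def by (simp add: plus_fun_def)

lemma hom_polys_scale:
  assumes "p \<in> hom_polys l"
  shows "(\<lambda>x. c * p x) \<in> hom_polys l"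
  using fun_space.span_scale[OF assms[unfolded hom_polys_def]]
  unfolding hom_polys_def by simp

lemma hom_polys_sum:
  assumes "\<And>i. i \<in> I \<Longrightarrow> p i \<in> hom_polys l"
  shows "(\<lambda>x. \<Sum>i\<in>I. p i x) \<in> hom_polys l"
  using assms
  by (induction I rule: infinite_finite_induct) (auto intro: hom_polys_zero hom_polys_add)

lemma hom_polys_induct [consumes 1, case_names zero step]:
  assumes "p \<in> hom_polys l"
    and "P (\<lambda>x. 0)"
    and "\<And>c \<alpha> q. sum \<alpha> UNIV = l \<Longrightarrow> q \<in> hom_polys l \<Longrightarrow> P q \<Longrightarrow> P (\<lambda>x. c * monomial \<alpha> x + q x)"
  shows "P p"
proof -
  have "p \<in> fun_space.span (monomial ` {\<alpha>. sum \<alpha> UNIV = l})"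
    using assms(1) by (simp add: hom_polys_def)
  then have "p \<in> hom_polys l \<and> P p"
  proof (induction rule: fun_space.span_induct_alt)
    case base
    then show ?case using assms(2) by (simp add: zero_fun_def hom_polys_zero)
  next
    case (step c f q)
    then obtain \<alpha> where a: "f = monomial \<alpha>" "sum \<alpha> UNIV = l" by auto
    have "f \<in> hom_polys l"
      unfolding hom_polys_def by (rule fun_space.span_base) (use step in auto)
    then show ?case using assms(3)[OF a(2), of q c] step a
      by (auto simp: plus_fun_def intro!: hom_polys_add hom_polys_scale)
  qed
  then show ?thesis ..
qed

lemma monomial_in_hom_polys: "sum \<alpha> UNIV = l \<Longrightarrow> monomial \<alpha> \<in> hom_polys l"
  unfolding hom_polys_def by (rule fun_space.span_base) auto

lemma hom_polys_const: "(\<lambda>x. c) \<in> hom_polys 0"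
proof -
  have "monomial (\<lambda>_. 0) \<in> hom_polys 0" by (rule monomial_in_hom_polys) simp
  from hom_polys_scale[OF this, of c] show ?thesis by (simp add: monomial_def)
qed

lemma hom_polys_mult:
  assumes "p \<in> hom_polys k" "q \<in> hom_polys l"
  shows "(\<lambda>x. p x * q x) \<in> hom_polys (k + l)"
  using assms(1)
proof (induction rule: hom_polys_induct)
  case zero
  then show ?case by (simp add: hom_polys_zero)
next
  case (step c \<alpha> p)
  have "(\<lambda>x. monomial \<alpha> x * q x) \<in> hom_polys (k + l)"
    using assms(2)
  proof (induction rule: hom_polys_induct)
    case zero
    then show ?case by (simp add: hom_polys_zero)
  next
    case (step c' \<beta> q)
    have "monomial (\<lambda>i. \<alpha> i + \<beta> i) \<in> hom_polys (k + l)"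
      by (rule monomial_in_hom_polys) (simp add: sum.distrib \<open>sum \<alpha> UNIV = k\<close> step)
    moreover have "monomial (\<lambda>i. \<alpha> i + \<beta> i) = (\<lambda>x. monomial \<alpha> x * monomial \<beta> x)"
      by (simp add: monomial_def fun_eq_iff power_add prod.distrib)
    ultimately have "(\<lambda>x. c' * (monomial \<alpha> x * monomial \<beta> x) + monomial \<alpha> x * q x) \<in> hom_polys (k + l)"
      using step.IH by (intro hom_polys_add hom_polys_scale) simp_all
    then show ?case by (simp add: algebra_simps)
  qed
  from hom_polys_add[OF hom_polys_scale[OF this, of c] step.IH]
  show ?case by (simp add: algebra_simps)
qed

lemma hom_polys_coord: "(\<lambda>x. x $ i) \<in> hom_polys 1"
proof -
  have "monomial (\<lambda>j. if j = i then 1 else 0) \<in> hom_polys 1"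
    by (rule monomial_in_hom_polys) simp
  moreover have "monomial (\<lambda>j. if j = i then 1 else 0) = (\<lambda>x. x $ i)"
    by (auto simp: monomial_def fun_eq_iff power_0 if_distrib cong: if_cong)
  ultimately show ?thesis by simp
qed

lemma hom_polys_linear:
  fixes f :: "real ^ 'n \<Rightarrow> real"
  assumes "linear f" shows "f \<in> hom_polys 1"
proof -
  have "f x = (\<Sum>i\<in>UNIV. f (axis i 1) * x $ i)" for x :: "real ^ 'n"
  proof -
    have "f x = f (\<Sum>i\<in>UNIV. x $ i *\<^sub>R axis i 1)"
      using basis_expansion[of x] by (simp add: scalar_mult_eq_scaleR)
    also have "\<dots> = (\<Sum>i\<in>UNIV. f (axis i 1) * x $ i)"
      using assms by (simp add: linear_sum linear_cmul mult.commute)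
    finally show ?thesis .
  qed
  then have "f = (\<lambda>x. \<Sum>i\<in>UNIV. f (axis i 1) * x $ i)" by blast
  moreover have "\<dots> \<in> hom_polys 1" by (intro hom_polys_sum hom_polys_scale hom_polys_coord)
  ultimately show ?thesis by simp
qed

lemma hom_polys_norm_power2: "(\<lambda>x. (norm x)\<^sup>2) \<in> hom_polys 2"
proof -
  have "(\<lambda>x::real^'n. x $ i * x $ i) \<in> hom_polys 2" for i
    using hom_polys_mult[OF hom_polys_coord[of i] hom_polys_coord[of i]] by (simp add: numeral_2_eq_2)
  then have "(\<lambda>x::real^'n. \<Sum>i\<in>UNIV. x $ i * x $ i) \<in> hom_polys 2" by (rule hom_polys_sum)
  then show ?thesis by (simp add: power2_norm_eq_inner inner_vec_def)
qed

lemma hom_polys_prod: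
  assumes "finite I" "\<And>i. i \<in> I \<Longrightarrow> p i \<in> hom_polys (k i)"
  shows "(\<lambda>x. \<Prod>i\<in>I. p i x) \<in> hom_polys (sum k I)"
  using assms
  by (induction I rule: finite_induct) (auto intro: hom_polys_const hom_polys_mult)

lemma hom_polys_power:
  assumes "p \<in> hom_polys k"
  shows "(\<lambda>x. p x ^ m) \<in> hom_polys (m * k)"
  using assms by (induction m) (auto intro: hom_polys_const hom_polys_mult)

lemma hom_polys_compose_linear:
  fixes R :: "real ^ 'n \<Rightarrow> real ^ 'n"
  assumes "linear R" "p \<in> hom_polys l"
  shows "(\<lambda>x. p (R x)) \<in> hom_polys l"
  using assms(2)
proof (induction rule: hom_polys_induct)
  case zero
  then show ?case by (simp add: hom_polys_zero)
next
  case (step c \<alpha> q)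
  have "linear (\<lambda>x. R x $ i)" for i
    using linear_compose[OF assms(1) bounded_linear.linear[OF bounded_linear_vec_nth]] by (simp add: o_def)
  then have "(\<lambda>x. R x $ i ^ \<alpha> i) \<in> hom_polys (\<alpha> i)" for i
    using hom_polys_power[OF hom_polys_linear, of "\<lambda>x. R x $ i" "\<alpha> i"] by simp
  then have "(\<lambda>x. monomial \<alpha> (R x)) \<in> hom_polys l"
    unfolding monomial_def using hom_polys_prod[of UNIV "\<lambda>i x. R x $ i ^ \<alpha> i" \<alpha>] step by simp
  then show ?case using step by (intro hom_polys_add hom_polys_scale)
qed

lemma hom_polys_scaleR:
  assumes "p \<in> hom_polys l" shows "p (c *\<^sub>R x) = c ^ l * p x"
  using assms
proof (induction rule: hom_polys_induct)
  case (step b \<alpha> q)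
  have "monomial \<alpha> (c *\<^sub>R x) = c ^ l * monomial \<alpha> x"
    by (simp add: monomial_def power_mult_distrib prod.distrib power_sum[symmetric] step)
  then show ?case using step by (simp add: algebra_simps)
qed simp

lemma real_polynomial_function_hom_polys:
  assumes "p \<in> hom_polys l" shows "real_polynomial_function p"
  using assms
proof (induction rule: hom_polys_induct)
  case zero
  show ?case by (rule real_polynomial_function.intros(2))
next
  case (step c \<alpha> q)
  have "real_polynomial_function (\<lambda>x. c * monomial \<alpha> x)" unfolding monomial_def
    by (intro real_polynomial_function.intros(4) real_polynomial_function.intros(2)
        real_polynomial_function_prod real_polynomial_function_power real_polynomial_function.intros(1))
       (auto intro: bounded_linear_vec_nth)
  with step show ?case by (intro real_polynomial_function.intros(3))
qed

text \<open>
  Passing to homogeneous parts is compatible with the generation of polynomials by linear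
  functionals, constants, sums and products; in a product the parts are collected along
  \<open>i + j = k\<close>.
\<close>

lemma real_polynomial_function_homogeneous_parts:
  fixes p :: "real ^ 'n \<Rightarrow> real"
  assumes "real_polynomial_function p"
  shows "\<exists>n P. (\<forall>j. P j \<in> hom_polys j) \<and> (\<forall>x. p x = (\<Sum>j\<le>n. P j x))"
  using assms
proof (induction rule: real_polynomial_function.induct)
  case (linear f)
  show ?case
    by (rule exI[of _ 1], rule exI[of _ "\<lambda>j. if j = 1 then f else (\<lambda>x. 0)"])
       (use hom_polys_linear[of f] linear bounded_linear.linear in \<open>auto simp: hom_polys_zero\<close>)
next
  case (const c)
  show ?case
    by (rule exI[of _ 0], rule exI[of _ "\<lambda>j. if j = 0 then (\<lambda>x. c) else (\<lambda>x. 0)"])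
       (auto simp: hom_polys_zero hom_polys_const)
next
  case (add f g)
  then obtain n P m Q where P: "\<And>j. P j \<in> hom_polys j" "\<And>x. f x = (\<Sum>j\<le>n. P j x)"
    and Q: "\<And>j. Q j \<in> hom_polys j" "\<And>x. g x = (\<Sum>j\<le>m. Q j x)" by metis
  define P' where "P' j = (if j \<le> n then P j else (\<lambda>x. 0))" for j
  define Q' where "Q' j = (if j \<le> m then Q j else (\<lambda>x. 0))" for j
  have "f x = (\<Sum>j\<le>max n m. P' j x)" for x
    unfolding P by (rule sum.mono_neutral_cong_left) (auto simp: P'_def)
  moreover have "g x = (\<Sum>j\<le>max n m. Q' j x)" for x
    unfolding Q by (rule sum.mono_neutral_cong_left) (auto simp: Q'_def)
  moreover have "(\<lambda>x. P' j x + Q' j x) \<in> hom_polys j" for j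
    by (intro hom_polys_add) (auto simp: P'_def Q'_def P Q hom_polys_zero)
  ultimately show ?case
    by (intro exI[of _ "max n m"] exI[of _ "\<lambda>j x. P' j x + Q' j x"]) (auto simp: sum.distrib)
next
  case (mult f g)
  then obtain n P m Q where P: "\<And>j. P j \<in> hom_polys j" "\<And>x. f x = (\<Sum>j\<le>n. P j x)"
    and Q: "\<And>j. Q j \<in> hom_polys j" "\<And>x. g x = (\<Sum>j\<le>m. Q j x)" by metis
  define R where "R k x = (\<Sum>(i,j) \<in> {(i,j). i \<le> n \<and> j \<le> m \<and> i + j = k}. P i x * Q j x)" for k x
  have R: "R k \<in> hom_polys k" for k
  proof -
    have "(\<lambda>x. case ij of (i,j) \<Rightarrow> P i x * Q j x) \<in> hom_polys k"
      if "ij \<in> {(i,j). i \<le> n \<and> j \<le> m \<and> i + j = k}" for ij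
      using that hom_polys_mult[OF P(1) Q(1)] by auto
    then show ?thesis unfolding R_def[abs_def] by (rule hom_polys_sum)
  qed
  have "f x * g x = (\<Sum>k\<le>n + m. R k x)" for x
  proof -
    have "f x * g x = (\<Sum>ij\<in>{..n}\<times>{..m}. P (fst ij) x * Q (snd ij) x)"
      by (simp add: P Q sum_product sum.cartesian_product case_prod_unfold)
    also have "\<dots> = (\<Sum>k\<le>n+m. \<Sum>ij | ij \<in> {..n}\<times>{..m} \<and> fst ij + snd ij = k. P (fst ij) x * Q (snd ij) x)"
      by (rule sum.group[symmetric]) auto
    also have "\<dots> = (\<Sum>k\<le>n + m. R k x)"
      unfolding R_def case_prod_unfold by (intro sum.cong refl) auto
    finally show ?thesis .
  qed
  with R show ?case by blast
qed

text \<open>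
  For fixed \<open>x\<close>, both sides of \<open>p (c x) = c ^ l * p x\<close> are polynomials in the scalar \<open>c\<close>;
  comparing the coefficients of \<open>c ^ l\<close> shows that \<open>p\<close> is its own part of degree \<open>l\<close>.
\<close>

lemma homogeneous_polynomial_in_hom_polys:
  fixes p :: "real ^ 'n \<Rightarrow> real"
  assumes "real_polynomial_function p" "\<And>c x. p (c *\<^sub>R x) = c ^ l * p x"
  shows "p \<in> hom_polys l"
proof -
  obtain n P where P: "\<And>j. P j \<in> hom_polys j" "\<And>x. p x = (\<Sum>j\<le>n. P j x)"
    using real_polynomial_function_homogeneous_parts[OF assms(1)] by blast
  define a where "a x j = (if j \<le> n then P j x else 0) - (if j = l then p x else 0)" for x j
  have "p x = (if l \<le> n then P l x else 0)" for x
  proof -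
    have "(\<Sum>j\<le>max n l. a x j * c ^ j) = 0" for c
    proof -
      have "p (c *\<^sub>R x) = (\<Sum>j\<le>n. P j x * c ^ j)"
        unfolding P(2) by (intro sum.cong refl) (simp add: hom_polys_scaleR[OF P(1)])
      also have "\<dots> = (\<Sum>j\<le>max n l. (if j \<le> n then P j x else 0) * c ^ j)"
        by (rule sum.mono_neutral_cong_left) auto
      finally have 1: "p (c *\<^sub>R x) = \<dots>" .
      have "c ^ l * p x = (\<Sum>j\<le>max n l. (if j = l then p x else 0) * c ^ j)"
        by (subst sum.remove[of _ l]) (auto intro!: sum.neutral)
      with 1 assms(2)[of c x] show ?thesis
        by (simp add: a_def left_diff_distrib sum_subtractf)
    qed
    then have "a x l = 0" using polyfun_eq_0[of "a x" "max n l"] by auto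
    then show ?thesis by (simp add: a_def)
  qed
  then have "p = (if l \<le> n then P l else (\<lambda>x. 0))" by auto
  then show ?thesis using P(1) by (auto simp: hom_polys_zero)
qed

section \<open>Polynomials on the sphere and their dimension\<close>

text \<open>
  Functions that agree on the sphere become equal after extension by \<open>0\<close>, so that restrictions
  to the sphere can be treated as elements of one vector space of functions.
\<close>

definition on_sphere :: "(real ^ 'n \<Rightarrow> real) \<Rightarrow> real ^ 'n \<Rightarrow> real" where
  "on_sphere f = (\<lambda>x. if norm x = 1 then f x else 0)"

text \<open>
  On the sphere a monomial can be multiplied by any power of \<open>(norm x)\<^sup>2\<close>. Up to this, the
  monomials of degree at most \<open>l\<close> are those of degrees \<open>l\<close> and \<open>l - 1\<close>, one for each parity; for
  \<open>l = 0\<close> only the constant remains.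
\<close>

definition sphere_monomials :: "nat \<Rightarrow> (real ^ 'n::finite \<Rightarrow> real) set" where
  "sphere_monomials l =
     (\<lambda>\<alpha>. on_sphere (monomial \<alpha>)) ` {\<alpha>. sum \<alpha> UNIV = l \<or> Suc (sum \<alpha> UNIV) = l}"

definition sphere_polys :: "nat \<Rightarrow> (real ^ 'n::finite \<Rightarrow> real) set" where
  "sphere_polys l = fun_space.span (sphere_monomials l)"

lemma sphere_polys_zero: "(\<lambda>x. 0) \<in> sphere_polys l"
  using fun_space.span_zero unfolding sphere_polys_def by (simp add: zero_fun_def)

lemma sphere_polys_add:
  assumes "p \<in> sphere_polys l" "q \<in> sphere_polys l"
  shows "(\<lambda>x. p x + q x) \<in> sphere_polys l"
  using fun_space.span_add[OF assms[unfolded sphere_polys_def]]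
  unfolding sphere_polys_def by (simp add: plus_fun_def)

lemma sphere_polys_scale:
  assumes "p \<in> sphere_polys l"
  shows "(\<lambda>x. c * p x) \<in> sphere_polys l"
  using fun_space.span_scale[OF assms[unfolded sphere_polys_def]]
  unfolding sphere_polys_def by simp

lemma sphere_polys_sum:
  assumes "\<And>i. i \<in> I \<Longrightarrow> p i \<in> sphere_polys l"
  shows "(\<lambda>x. \<Sum>i\<in>I. p i x) \<in> sphere_polys l"
  using assms
  by (induction I rule: infinite_finite_induct) (auto intro: sphere_polys_zero sphere_polys_add)

lemma sphere_polys_induct [consumes 1, case_names zero step]:
  assumes "p \<in> sphere_polys l"
    and "P (\<lambda>x. 0)"
    and "\<And>c \<alpha> q. sum \<alpha> UNIV = l \<or> Suc (sum \<alpha> UNIV) = l \<Longrightarrow> P q \<Longrightarrow>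
           P (\<lambda>x. c * on_sphere (monomial \<alpha>) x + q x)"
  shows "P p"
proof -
  have "p \<in> fun_space.span (sphere_monomials l)"
    using assms(1) by (simp add: sphere_polys_def)
  then show ?thesis
  proof (induction rule: fun_space.span_induct_alt)
    case base
    then show ?case using assms(2) by (simp add: zero_fun_def)
  next
    case (step c f q)
    then show ?case using assms(3)[of _ q c] by (auto simp: plus_fun_def sphere_monomials_def)
  qed
qed

lemma on_sphere_hom_polys:
  assumes "p \<in> hom_polys k" "k = l \<or> Suc k = l"
  shows "on_sphere p \<in> sphere_polys l"
  using assms(1)
proof (induction rule: hom_polys_induct)
  case zero
  then show ?case using sphere_polys_zero by (simp add: on_sphere_def)
next
  case (step c \<alpha> q)
  have "on_sphere (monomial \<alpha>) \<in> sphere_polys l"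
    unfolding sphere_polys_def
    by (rule fun_space.span_base) (use step assms in \<open>auto simp: sphere_monomials_def\<close>)
  then have "(\<lambda>x. c * on_sphere (monomial \<alpha>) x + on_sphere q x) \<in> sphere_polys l"
    using step by (intro sphere_polys_add sphere_polys_scale)
  then show ?case by (simp add: on_sphere_def if_distrib cong: if_cong)
qed

text \<open>
  A monomial of degree \<open>l - 1\<close> is multiplied by \<open>(norm x)\<^sup>2\<close>, which raises its degree to \<open>l + 1\<close>
  and does not change it on the sphere.
\<close>

lemma sphere_polys_Suc: "p \<in> sphere_polys l \<Longrightarrow> p \<in> sphere_polys (Suc l)"
proof (induction rule: sphere_polys_induct)
  case (step c \<alpha> q)
  have "on_sphere (monomial \<alpha>) \<in> sphere_polys (Suc l)"
  proof (cases "sum \<alpha> UNIV = l")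
    case True
    then show ?thesis by (intro on_sphere_hom_polys[of _ l] monomial_in_hom_polys) auto
  next
    case False
    then have "Suc (sum \<alpha> UNIV) = l" using step by auto
    then have "(\<lambda>x. monomial \<alpha> x * (norm x)\<^sup>2) \<in> hom_polys (Suc l)"
      using hom_polys_mult[OF monomial_in_hom_polys[OF refl, of \<alpha>] hom_polys_norm_power2] by simp
    then have "on_sphere (\<lambda>x. monomial \<alpha> x * (norm x)\<^sup>2) \<in> sphere_polys (Suc l)"
      by (rule on_sphere_hom_polys) simp
    moreover have "on_sphere (\<lambda>x. monomial \<alpha> x * (norm x)\<^sup>2) = on_sphere (monomial \<alpha>)"
      by (auto simp: on_sphere_def)
    ultimately show ?thesis by simp
  qed
  then show ?case using step by (intro sphere_polys_add sphere_polys_scale)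
qed (rule sphere_polys_zero)

lemma sphere_polys_mono: "k \<le> l \<Longrightarrow> sphere_polys k \<subseteq> sphere_polys l"
  by (rule lift_Suc_mono_le[of sphere_polys]) (auto intro: sphere_polys_Suc)

lemma sphere_polys_orthogonal_transformation:
  fixes R :: "real ^ 'n \<Rightarrow> real ^ 'n"
  assumes "orthogonal_transformation R" "p \<in> sphere_polys l"
  shows "(\<lambda>x. p (R x)) \<in> sphere_polys l"
  using assms(2)
proof (induction rule: sphere_polys_induct)
  case (step c \<alpha> q)
  have "(\<lambda>x. monomial \<alpha> (R x)) \<in> hom_polys (sum \<alpha> UNIV)"
    using orthogonal_transformation_linear[OF assms(1)]
    by (rule hom_polys_compose_linear) (rule monomial_in_hom_polys[OF refl])
  then have "on_sphere (\<lambda>x. monomial \<alpha> (R x)) \<in> sphere_polys l"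
    using step(1) by (rule on_sphere_hom_polys)
  moreover have "on_sphere (\<lambda>x. monomial \<alpha> (R x)) = (\<lambda>x. on_sphere (monomial \<alpha>) (R x))"
    by (auto simp: on_sphere_def orthogonal_transformation_norm[OF assms(1)])
  ultimately show ?case using step by (intro sphere_polys_add sphere_polys_scale) auto
qed (rule sphere_polys_zero)

lemma sphere_polysE:
  assumes "f \<in> sphere_polys l"
  obtains p where "real_polynomial_function p" "f = on_sphere p"
proof -
  have "\<exists>p. real_polynomial_function p \<and> f = on_sphere p"
    using assms
  proof (induction rule: sphere_polys_induct)
    case zero
    show ?case by (rule exI[of _ "\<lambda>x. 0"]) (auto simp: on_sphere_def real_polynomial_function.intros(2))
  next
    case (step c \<alpha> q)
    then obtain p where p: "real_polynomial_function p" "q = on_sphere p" by blast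
    have "real_polynomial_function (\<lambda>x. c * monomial \<alpha> x + p x)"
      by (intro real_polynomial_function.intros(2-4) p
          real_polynomial_function_hom_polys[OF monomial_in_hom_polys[OF refl]])
    moreover have "(\<lambda>x. c * on_sphere (monomial \<alpha>) x + q x) = on_sphere (\<lambda>x. c * monomial \<alpha> x + p x)"
      by (auto simp: on_sphere_def p)
    ultimately show ?case by blast
  qed
  then show ?thesis using that by blast
qed

lemma on_sphere_polynomial:
  fixes p :: "real ^ 'n \<Rightarrow> real"
  assumes "real_polynomial_function p"
  obtains l where "on_sphere p \<in> sphere_polys l"
proof -
  obtain n P where P: "\<And>j. P j \<in> hom_polys j" "\<And>x. p x = (\<Sum>j\<le>n. P j x)"
    using real_polynomial_function_homogeneous_parts[OF assms] by blast
  have "on_sphere (P j) \<in> sphere_polys n" if "j \<le> n" for j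
    using on_sphere_hom_polys[OF P(1)[of j], of j] sphere_polys_mono[OF that] by auto
  then have "(\<lambda>x. \<Sum>j\<le>n. on_sphere (P j) x) \<in> sphere_polys n" by (intro sphere_polys_sum) auto
  moreover have "(\<lambda>x. \<Sum>j\<le>n. on_sphere (P j) x) = on_sphere p"
    by (auto simp: on_sphere_def P(2) fun_eq_iff)
  ultimately show ?thesis using that by metis
qed

text \<open>
  After an enumeration of the index type an exponent function becomes a list of natural numbers
  with prescribed length and sum.
\<close>

lemma finite_exponents: "finite {\<alpha> :: 'n::finite \<Rightarrow> nat. sum \<alpha> UNIV = l}" (is ?fin)
  and card_exponents:
    "CARD('n) = Suc d \<Longrightarrow> card {\<alpha> :: 'n \<Rightarrow> nat. sum \<alpha> UNIV = l} \<le> (l + d) choose d"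
    (is "_ \<Longrightarrow> ?card")
proof -
  obtain xs :: "'n list" where xs: "set xs = UNIV" "distinct xs"
    using finite_distinct_list[of "UNIV :: 'n set"] by auto
  let ?A = "{\<alpha> :: 'n \<Rightarrow> nat. sum \<alpha> UNIV = l}"
    and ?B = "{ys :: nat list. length ys = CARD('n) \<and> sum_list ys = l}"
  have B: "card ?B = (l + CARD('n) - 1) choose l" by (rule card_length_sum_list)
  have "CARD('n) > 0" by simp
  then have "l \<le> l + CARD('n) - 1" by linarith
  then have "card ?B > 0" unfolding B by (rule zero_less_binomial)
  then have fin: "finite ?B" by (rule card_ge_0_finite)
  have inj: "inj_on (\<lambda>\<alpha>. map \<alpha> xs) ?A"
    by (rule inj_onI) (auto simp: fun_eq_iff xs)
  have len: "length xs = CARD('n)" using distinct_card[OF xs(2)] xs(1) by simp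
  have sub: "(\<lambda>\<alpha>. map \<alpha> xs) ` ?A \<subseteq> ?B"
    using xs len by (auto simp: sum_list_distinct_conv_sum_set)
  show ?fin using inj sub fin by (meson finite_imageD finite_subset)
  assume d: "CARD('n) = Suc d"
  have "card ?A \<le> card ?B" by (rule card_inj_on_le[OF inj sub fin])
  also have "card ?B = (l + d) choose d" unfolding B using d binomial_symmetric[of d "l + d"] by simp
  finally show ?card .
qed

text \<open>
  The number of monomials of degree \<open>l\<close> in \<open>d + 1\<close> variables minus the number of those of degree
  \<open>l - 2\<close>, after Pascal's rule and with \<open>d = e + 2\<close>. In this form the partial sums telescope.
\<close>

lemma harmonic_dim_binomial:
  "harmonic_dim (Suc (Suc e)) l = ((l + Suc e) choose Suc e) + ((l + e) choose Suc e)"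
proof -
  have "real (((l + Suc e) choose Suc e) + ((l + e) choose Suc e)) =
        (2 * real l + real e + 1) * fact (l + e) / (fact (Suc e) * fact l)"
  proof (cases l)
    case 0
    then show ?thesis using fact_nonzero[of "Suc e", where ?'a = real]
      by (simp del: fact_Suc add: binomial_eq_0) (simp add: field_simps)
  next
    case (Suc m)
    have 1: "real ((l + Suc e) choose (Suc e)) = fact (l + Suc e) / (fact (Suc e) * fact l)"
      by (subst binomial_fact) auto
    have 2: "real ((l + e) choose (Suc e)) = fact (l + e) / (fact (Suc e) * fact m)"
      using Suc by (subst binomial_fact) auto
    have 3: "fact l = real l * fact m" using Suc by simp
    have 4: "fact (l + Suc e) = (real l + real e + 1) * (fact (l + e) :: real)"
      by (simp add: algebra_simps)
    have "real l > 0" using Suc by simp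
    then show ?thesis unfolding of_nat_add 1 2 4 3
      by (simp add: field_simps del: fact_Suc)
  qed
  also have "\<dots> = real (harmonic_dim (Suc (Suc e)) l)"
    using Gamma_fact[of "l + e", where 'a = real] Gamma_fact[of l, where 'a = real]
      Gamma_fact[of "Suc e", where 'a = real]
    by (subst real_harmonic_dim) (simp_all add: algebra_simps)
  finally show ?thesis by (metis of_nat_eq_iff)
qed

text \<open>
  The right-hand side counts the monomials of degrees \<open>l\<close> and \<open>l - 1\<close> in \<open>d + 1\<close> variables,
  which is why a system with \<open>harmonic_dim d k\<close> members in each degree \<open>k \<le> l\<close> has just enough
  members to span \<open>sphere_polys l\<close>.
\<close>

lemma sum_harmonic_dim:
  assumes "d \<ge> 2"
  shows "(\<Sum>k\<le>l. harmonic_dim d k) = ((l + d) choose d) + (if l = 0 then 0 else (l - 1 + d) choose d)"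
proof -
  obtain e where d: "d = Suc (Suc e)" using assms by (metis add_2_eq_Suc le_Suc_ex)
  show ?thesis unfolding d
  proof (induction l)
    case 0
    then show ?case by (simp add: harmonic_dim_binomial binomial_eq_0)
  next
    case (Suc l)
    then show ?case by (cases l) (simp_all add: harmonic_dim_binomial binomial_eq_0)
  qed
qed

lemma finite_sphere_monomials: "finite (sphere_monomials l :: (real ^ 'n \<Rightarrow> real) set)"
proof -
  have "finite {\<alpha> :: 'n \<Rightarrow> nat. sum \<alpha> UNIV = l \<or> Suc (sum \<alpha> UNIV) = l}"
    by (rule finite_subset[OF _ finite_UnI[OF finite_exponents[of l] finite_exponents[of "l - 1"]]]) auto
  then show ?thesis unfolding sphere_monomials_def by (rule finite_imageI)
qed

lemma card_sphere_monomials: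
  assumes "CARD('n) = d + 1" "d \<ge> 2"
  shows "card (sphere_monomials l :: (real ^ 'n \<Rightarrow> real) set) \<le> (\<Sum>k\<le>l. harmonic_dim d k)"
proof -
  let ?A = "\<lambda>l. {\<alpha> :: 'n \<Rightarrow> nat. sum \<alpha> UNIV = l}"
  let ?B = "{\<alpha> :: 'n \<Rightarrow> nat. sum \<alpha> UNIV = l \<or> Suc (sum \<alpha> UNIV) = l}"
  have B: "?B = ?A l \<union> (if l = 0 then {} else ?A (l - 1))" by (cases l) auto
  have fin: "finite ?B" unfolding B using finite_exponents[of l] finite_exponents[of "l - 1"] by (cases l) (simp_all del: sum_eq_0_iff)
  have "card (sphere_monomials l :: (real ^ 'n \<Rightarrow> real) set) \<le> card ?B"
    unfolding sphere_monomials_def by (rule card_image_le[OF fin])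
  also have "\<dots> \<le> card (?A l) + card (if l = 0 then {} else ?A (l - 1))"
    unfolding B by (rule card_Un_le)
  also have "\<dots> \<le> ((l + d) choose d) + (if l = 0 then 0 else (l - 1 + d) choose d)"
    using card_exponents[where 'n = 'n, of d l] card_exponents[where 'n = 'n, of d "l - 1"] assms
    by (intro add_mono) auto
  finally show ?thesis by (simp add: sum_harmonic_dim[OF assms(2)])
qed

section \<open>Rotation invariance of the surface measure\<close>

text \<open>
  Orthogonal maps carry balls to balls of the same radius. By Vitali's theorem an open set is,
  up to a null set, a disjoint union of balls, and its image contains the disjoint images of
  these balls.
\<close>

lemma emeasure_open_le_orthogonal_image:
  fixes f :: "'a::euclidean_space \<Rightarrow> 'a"
  assumes f: "orthogonal_transformation f" and U: "open U"
  shows "emeasure lborel U \<le> emeasure lborel (f ` U)"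
proof -
  define K where "K = {(a,r). 0 < r \<and> ball a r \<subseteq> U}"
  have cov: "\<exists>i. i \<in> K \<and> x \<in> ball (fst i) (snd i) \<and> snd i < d" if xd: "x \<in> U" "0 < d" for x d
  proof -
    obtain e where e: "e > 0" "ball x e \<subseteq> U" by (rule openE[OF U xd(1)])
    have "ball x (min e (d / 2)) \<subseteq> U" using e(2) by (auto simp: subset_iff)
    then have "(x, min e (d / 2)) \<in> K" using e xd by (simp add: K_def)
    then show ?thesis using e xd by (intro exI[of _ "(x, min e (d / 2))"]) simp
  qed
  obtain C where C: "countable C" "C \<subseteq> K"
    "pairwise (\<lambda>i j. disjnt (ball (fst i) (snd i)) (ball (fst j) (snd j))) C"
    "negligible (U - (\<Union>i\<in>C. ball (fst i) (snd i)))"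
    by (rule Vitali_covering_theorem_balls[of U K fst snd, OF cov])
  define V where "V i = ball (fst i) (snd i :: real)" for i :: "'a \<times> real"
  have V: "open (V i)" "emeasure lborel (f ` V i) = emeasure lborel (V i)" "open (f ` V i)" if "i \<in> C" for i
  proof -
    have "snd i > 0" using that C by (auto simp: K_def)
    then show "emeasure lborel (f ` V i) = emeasure lborel (V i)" "open (V i)" "open (f ` V i)"
      by (auto simp: V_def image_orthogonal_transformation_ball[OF f] emeasure_ball)
  qed
  have Vm: "V i \<in> sets lborel" "f ` V i \<in> sets lborel" if "i \<in> C" for i
    using V[OF that] by auto
  have disj: "disjoint_family_on V C"
    using C(3) by (auto simp: disjoint_family_on_def pairwise_def disjnt_def V_def)
  then have disj': "disjoint_family_on (\<lambda>i. f ` V i) C"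
    using orthogonal_transformation_inj[OF f]
    unfolding disjoint_family_on_def by (metis image_Int image_empty)
  have un: "(\<Union>i\<in>C. V i) \<in> sets borel" "(\<Union>i\<in>C. f ` V i) \<in> sets borel"
    using V by (intro borel_open open_UN ballI; blast)+
  have fU: "open (f ` U)"
    by (rule open_surjective_linear_image[OF U orthogonal_transformation_linear[OF f] orthogonal_transformation_surj[OF f]])
  have U': "U \<in> sets borel" by (rule borel_open[OF U])
  then have "U - (\<Union>i\<in>C. V i) \<in> sets borel" using un by (intro sets.Diff)
  then have null: "emeasure lborel (U - (\<Union>i\<in>C. V i)) = 0"
    using C(4) by (simp add: negligible_iff_emeasure0 V_def)
  have "emeasure lborel U \<le> emeasure lborel ((U - (\<Union>i\<in>C. V i)) \<union> (\<Union>i\<in>C. V i))"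
    by (rule emeasure_mono) (use U' un in \<open>auto simp del: UN_simps\<close>)
  also have "\<dots> \<le> emeasure lborel (U - (\<Union>i\<in>C. V i)) + emeasure lborel (\<Union>i\<in>C. V i)"
    by (rule emeasure_subadditive) (use U' un in \<open>auto simp del: UN_simps\<close>)
  also have "\<dots> = (\<integral>\<^sup>+i. emeasure lborel (V i) \<partial>count_space C)"
    unfolding null by (simp add: emeasure_UN_countable[OF Vm(1) C(1) disj])
  also have "\<dots> = (\<integral>\<^sup>+i. emeasure lborel (f ` V i) \<partial>count_space C)"
    by (intro nn_integral_cong) (simp add: V)
  also have "\<dots> = emeasure lborel (\<Union>i\<in>C. f ` V i)"
    by (simp add: emeasure_UN_countable[OF Vm(2) C(1) disj'])
  also have "\<dots> \<le> emeasure lborel (f ` U)"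
  proof (rule emeasure_mono)
    have "V i \<subseteq> U" if "i \<in> C" for i using that C(2) by (auto simp: K_def V_def case_prod_unfold)
    then show "(\<Union>i\<in>C. f ` V i) \<subseteq> f ` U" by blast
  qed (use fU in simp)
  finally show ?thesis .
qed

text \<open>
  The previous inequality holds for the map and for its inverse, so that boxes keep their
  volume.
\<close>

lemma lborel_distr_orthogonal:
  fixes f :: "'a::euclidean_space \<Rightarrow> 'a"
  assumes f: "orthogonal_transformation f"
  shows "distr lborel borel f = lborel"
proof (rule lborel_eqI[symmetric])
  fix l u :: 'a assume le: "\<And>b. b \<in> Basis \<Longrightarrow> l \<bullet> b \<le> u \<bullet> b"
  note bij = orthogonal_transformation_bij[OF f]
  note g = orthogonal_transformation_inv[OF f]
  have cont: "continuous_on UNIV f"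
    by (intro linear_continuous_on linear_conv_bounded_linear[THEN iffD1]
        orthogonal_transformation_linear[OF f])
  have op: "open (f -` box l u)" using continuous_open_vimage[OF open_box] cont
    by (auto simp: continuous_on_eq_continuous_at)
  have eq: "f ` (f -` box l u) = box l u" using bij by (auto simp: bij_def)
  have "inv f ` box l u = f -` box l u" using bij by (simp add: bij_vimage_eq_inv_image)
  then have "emeasure lborel (f -` box l u) = emeasure lborel (box l u)"
    using emeasure_open_le_orthogonal_image[OF f op] emeasure_open_le_orthogonal_image[OF g open_box[of l u]]
    by (simp only: eq)
  then show "emeasure (distr lborel borel f) (box l u) = (\<Prod>b\<in>Basis. (u - l) \<bullet> b)"
    using le by (subst emeasure_distr) (auto intro!: borel_measurable_continuous_onI cont simp: emeasure_lborel_box)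
qed simp

definition unit_vol :: "'n::finite itself \<Rightarrow> real" where
  "unit_vol _ = measure lborel (ball 0 1 :: (real ^ 'n) set)"

lemma unit_vol_pos: "unit_vol TYPE('n::finite) > 0"
  using content_ball_pos[of 1 "0 :: real ^ 'n"] by (simp add: unit_vol_def)

text \<open>
  Integrals over the sphere are averages over the unit ball of functions that are constant along
  rays.
\<close>

lemma integral_sphere_measure:
  fixes g :: "real ^ 'n \<Rightarrow> real"
  assumes g[measurable]: "g \<in> borel_measurable borel"
  shows "(LINT x|sphere_measure. g x) =
           (LINT x|lborel. indicator (ball 0 1) x * g (x /\<^sub>R norm x)) / unit_vol TYPE('n)"
proof -
  let ?B = "ball 0 1 :: (real ^ 'n) set"
  let ?v = "unit_vol TYPE('n)"
  note v = unit_vol_pos[where 'n='n]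
  have B[measurable]: "?B \<in> sets borel" by simp
  have S[measurable]: "sphere (0 :: real ^ 'n) 1 \<in> sets borel" by simp
  have n[measurable]: "(\<lambda>x::real^'n. x /\<^sub>R norm x) \<in> borel_measurable borel" by simp
  have em: "emeasure lborel ?B = ennreal ?v"
    using emeasure_lborel_ball_finite[of "0::real^'n" 1]
    by (simp add: unit_vol_def emeasure_eq_ennreal_measure less_top)
  have um: "uniform_measure lborel ?B = density lborel (\<lambda>x. ennreal (indicator ?B x / ?v))"
    unfolding uniform_measure_def em
  proof (rule arg_cong[of _ _ "density lborel"], rule ext)
    fix x show "indicator ?B x / ennreal ?v = ennreal (indicator ?B x / ?v)"
      using v divide_ennreal[of 1 ?v] by (simp add: indicator_def)
  qed
  have "(LINT x|sphere_measure. g x) =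
      (LINT x|distr (uniform_measure lborel ?B) borel (\<lambda>x. x /\<^sub>R norm x). indicator (sphere 0 1) x *\<^sub>R g x)"
    unfolding sphere_measure_def by (rule integral_restrict_space) auto
  also have "\<dots> = (LINT x|uniform_measure lborel ?B. indicator (sphere 0 1) (x /\<^sub>R norm x) *\<^sub>R g (x /\<^sub>R norm x))"
    unfolding um by (rule integral_distr) measurable
  also have "\<dots> = (LINT x|lborel. (indicator ?B x / unit_vol TYPE('n)) *\<^sub>R
                    (indicator (sphere 0 1) (x /\<^sub>R norm x) *\<^sub>R g (x /\<^sub>R norm x)))"
    unfolding um
  proof (rule integral_density)
    show "AE x in lborel. 0 \<le> indicator ?B x / unit_vol TYPE('n)"
      using unit_vol_pos[where 'n='n] by (intro AE_I2) (simp add: indicator_def)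
  qed measurable
  also have "\<dots> = (LINT x|lborel. indicator ?B x * g (x /\<^sub>R norm x) / unit_vol TYPE('n))"
  proof (rule integral_cong_AE)
    have "AE x in lborel. x \<noteq> (0 :: real ^ 'n)" by (rule AE_lborel_singleton)
    then show "AE x in lborel. (indicator ?B x / unit_vol TYPE('n)) *\<^sub>R
                    (indicator (sphere 0 1) (x /\<^sub>R norm x) *\<^sub>R g (x /\<^sub>R norm x)) =
        indicator ?B x * g (x /\<^sub>R norm x) / unit_vol TYPE('n)"
      by eventually_elim (auto simp: indicator_def)
  qed measurable
  finally show ?thesis by simp
qed

lemma integral_sphere_orthogonal:
  fixes g :: "real ^ 'n \<Rightarrow> real" and f :: "real ^ 'n \<Rightarrow> real ^ 'n"
  assumes g[measurable]: "g \<in> borel_measurable borel" and f: "orthogonal_transformation f"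
  shows "(LINT x|sphere_measure. g (f x)) = (LINT x|sphere_measure. g x)"
proof -
  have B[measurable]: "ball (0 :: real ^ 'n) 1 \<in> sets borel" by simp
  have n[measurable]: "(\<lambda>x::real^'n. x /\<^sub>R norm x) \<in> borel_measurable borel" by simp
  have fm[measurable]: "f \<in> borel_measurable borel"
    by (intro borel_measurable_continuous_onI linear_continuous_on linear_conv_bounded_linear[THEN iffD1]
        orthogonal_transformation_linear[OF f])
  have "(LINT x|lborel. indicator (ball 0 1) x * g (x /\<^sub>R norm x)) =
        (LINT x|distr lborel borel f. indicator (ball 0 1) x * g (x /\<^sub>R norm x))"
    by (simp add: lborel_distr_orthogonal[OF f])
  also have "\<dots> = (LINT x|lborel. indicator (ball 0 1) (f x) * g (f x /\<^sub>R norm (f x)))"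
    by (rule integral_distr) (simp, measurable)
  also have "\<dots> = (LINT x|lborel. indicator (ball 0 1) x * g (f (x /\<^sub>R norm x)))"
    by (simp add: indicator_def orthogonal_transformation_norm[OF f]
        orthogonal_transformation_scaleR[OF f] cong: if_cong)
  finally show ?thesis by (simp add: integral_sphere_measure)
qed

section \<open>Integration by parts in space\<close>

lemma integrable_continuous_compact_support:
  fixes F :: "'a::euclidean_space \<Rightarrow> real"
  assumes "continuous_on UNIV F" "\<And>x. norm x \<ge> r \<Longrightarrow> F x = 0"
  shows "integrable lborel F"
proof -
  have "integrable lborel (\<lambda>x. indicator (cball 0 r) x *\<^sub>R F x)"
    by (rule borel_integrable_compact) (auto intro: continuous_on_subset[OF assms(1)])
  also have "(\<lambda>x. indicator (cball 0 r) x *\<^sub>R F x) = F"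
    using assms(2) by (fastforce simp: indicator_def)
  finally show ?thesis .
qed

text \<open>
  By translation invariance the difference quotients of \<open>F\<close> have integral \<open>0\<close>. They converge to
  \<open>G\<close> and, by the mean value theorem, are dominated by a multiple of the indicator of the ball
  of radius \<open>2\<close>.
\<close>

lemma integral_directional_derivative_zero:
  fixes F G :: "'a::euclidean_space \<Rightarrow> real"
  assumes F: "continuous_on UNIV F" "\<And>x. norm x \<ge> 1 \<Longrightarrow> F x = 0"
    and G: "continuous_on UNIV G" "\<And>x. norm x \<ge> 1 \<Longrightarrow> G x = 0"
    and e: "norm e = 1"
    and D: "\<And>x t. ((\<lambda>t. F (x + t *\<^sub>R e)) has_real_derivative G (x + t *\<^sub>R e)) (at t)"
  shows "(LINT x|lborel. G x) = 0"
proof -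
  \<comment> \<open>step sizes of at most \<open>1\<close>, which keep the supports inside the ball of radius \<open>2\<close>\<close>
  define h where "h k = inverse (real (Suc k))" for k
  define Q where "Q k x = (F (x + h k *\<^sub>R e) - F x) / h k" for k x
  have h: "0 < h k" "h k \<le> 1" for k by (auto simp: h_def inverse_le_1_iff)
  have [measurable]: "F \<in> borel_measurable borel" "G \<in> borel_measurable borel"
    using F G by (auto intro: borel_measurable_continuous_onI)
  have intF: "integrable lborel F" by (rule integrable_continuous_compact_support[OF F])
  have trans: "integrable lborel (\<lambda>x. F (x + c))" "(LINT x|lborel. F (x + c)) = (LINT x|lborel. F x)" for c
  proof -
    have "integrable (distr lborel borel ((+) c)) F" using intF by (simp add: lborel_distr_plus)
    then show "integrable lborel (\<lambda>x. F (x + c))" by (subst (asm) integrable_distr_eq) (auto simp: add.commute)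
    have "(LINT x|distr lborel borel ((+) c). F x) = (LINT x|lborel. F (c + x))" by (rule integral_distr) auto
    then show "(LINT x|lborel. F (x + c)) = (LINT x|lborel. F x)" by (simp add: lborel_distr_plus add.commute)
  qed
  have Q0: "(LINT x|lborel. Q k x) = 0" for k
    unfolding Q_def using intF trans by simp
  obtain M where M: "\<And>x. \<bar>G x\<bar> \<le> M"
  proof -
    have "compact (G ` cball 0 1)" by (intro compact_continuous_image continuous_on_subset[OF G(1)]) auto
    then obtain M where M: "\<And>x. x \<in> cball 0 1 \<Longrightarrow> \<bar>G x\<bar> \<le> M"
      using compact_imp_bounded bounded_iff by (metis image_eqI real_norm_def)
    have "\<bar>G x\<bar> \<le> M" for x
      using M[of x] M[of 0] G(2)[of x] abs_ge_zero[of "G 0"] by (cases "norm x \<le> 1") auto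
    then show ?thesis using that by blast
  qed
  have bound: "\<bar>Q k x\<bar> \<le> M * indicator (cball 0 2) x" for k x
  proof (cases "norm x \<le> 2")
    case True
    obtain z where "F (x + h k *\<^sub>R e) - F (x + 0 *\<^sub>R e) = (h k - 0) * G (x + z *\<^sub>R e)"
      using MVT2[of 0 "h k" "\<lambda>t. F (x + t *\<^sub>R e)" "\<lambda>t. G (x + t *\<^sub>R e)"] h D by auto
    then have "Q k x = G (x + z *\<^sub>R e)" using h[of k] by (simp add: Q_def)
    then show ?thesis using True M by simp
  next
    case False
    have "norm (x + h k *\<^sub>R e) \<ge> norm x - norm (h k *\<^sub>R e)" by (rule norm_diff_ineq)
    then have "norm (x + h k *\<^sub>R e) \<ge> 1" using False e h[of k] by simp
    then show ?thesis using False by (simp add: Q_def F)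
  qed
  have "(\<lambda>k. LINT x|lborel. Q k x) \<longlonglongrightarrow> (LINT x|lborel. G x)"
  proof (rule integral_dominated_convergence)
    show "integrable lborel (\<lambda>x. M * indicator (cball 0 2) x :: real)"
      by (intro integrable_mult_right integrable_real_indicator emeasure_compact_finite compact_cball borel_closed[THEN sets_lborel[THEN equalityD2, THEN subsetD]]) auto
    have "(\<lambda>k. Q k x) \<longlonglongrightarrow> G x" for x
    proof -
      have "h \<longlonglongrightarrow> 0" unfolding h_def[abs_def] by (rule LIMSEQ_inverse_real_of_nat)
      then have "filterlim h (at 0) sequentially" using h by (auto simp: filterlim_at intro!: always_eventually less_imp_neq[THEN not_sym])
      moreover have "((\<lambda>t. (F (x + (0 + t) *\<^sub>R e) - F (x + 0 *\<^sub>R e)) / t) \<longlongrightarrow> G (x + 0 *\<^sub>R e)) (at 0)"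
        using D[of x 0] by (simp add: DERIV_def)
      ultimately show ?thesis unfolding Q_def[abs_def] by (auto dest: filterlim_compose)
    qed
    then show "AE x in lborel. (\<lambda>k. Q k x) \<longlonglongrightarrow> G x" by simp
    show "AE x in lborel. norm (Q k x) \<le> M * indicator (cball 0 2) x" for k using bound by simp
  qed (auto simp: Q_def[abs_def])
  then show ?thesis by (simp add: Q0 LIMSEQ_const_iff)
qed

section \<open>Radial weights and homogeneous polynomials\<close>

lemma integral_lborel_scaleR:
  fixes f :: "'a::euclidean_space \<Rightarrow> real"
  assumes [measurable]: "f \<in> borel_measurable borel" and q: "q > 0"
  shows "(LINT x|lborel. f x) = q ^ DIM('a) * (LINT x|lborel. f (q *\<^sub>R x))"
proof -
  have "(LINT x|lborel. f x) = (LINT x|density (distr lborel borel (\<lambda>x. 0 + q *\<^sub>R x)) (\<lambda>_. \<bar>q\<bar> ^ DIM('a)). f x)"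
    using q by (subst lborel_affine[of q 0]) auto
  also have "\<dots> = (LINT x|distr lborel borel (\<lambda>x. 0 + q *\<^sub>R x). (\<bar>q\<bar> ^ DIM('a)) *\<^sub>R f x)"
    by (rule integral_density) auto
  also have "\<dots> = (LINT x|lborel. (\<bar>q\<bar> ^ DIM('a)) *\<^sub>R f (0 + q *\<^sub>R x))"
    by (rule integral_distr) auto
  finally show ?thesis using q by simp
qed

text \<open>
  A function that is constant along rays separates from any radial weight. For the weight
  \<open>norm x ^ k\<close>, scaling shows that the ball of radius \<open>q\<close> contributes the fraction \<open>q ^ (n + k)\<close>
  of the integral over the unit ball, where \<open>n\<close> is the dimension. On the thin shell
  \<open>q \<le> norm x < 1\<close> the weight lies between \<open>q ^ k\<close> and \<open>1\<close>, so the integrals over the shell with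
  and without the weight differ by a term of second order in \<open>1 - q\<close>. Division by \<open>1 - q\<close> and
  the limit \<open>q \<longlongrightarrow> 1\<close> give the claim.
\<close>

lemma radial_moment:
  fixes h :: "real ^ 'n \<Rightarrow> real"
  assumes h[measurable]: "h \<in> borel_measurable borel" and bound: "\<And>x. \<bar>h x\<bar> \<le> C"
    and hom: "\<And>c x. c > 0 \<Longrightarrow> h (c *\<^sub>R x) = h x"
  shows "real (CARD('n) + k) * (LINT x|lborel. indicator (ball 0 1) x * (norm x ^ k * h x)) =
         real CARD('n) * (LINT x|lborel. indicator (ball 0 1) x * h x)"
proof -
  let ?n = "CARD('n)"
  define v where "v = unit_vol TYPE('n)"
  define J where "J k g = (LINT x|lborel. indicator (ball 0 1 :: (real^'n) set) x * (norm x ^ k * g x))"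
    for k :: nat and g
  have v: "v > 0" unfolding v_def by (rule unit_vol_pos)
  have Bm[measurable]: "ball (0 :: real ^ 'n) q \<in> sets borel" for q by simp
  have ind: "integrable lborel (indicator (ball 0 q) :: real ^ 'n \<Rightarrow> real)" for q :: real
    using emeasure_lborel_ball_finite[of "0::real^'n" q] by (intro integrable_real_indicator) auto
  have int: "integrable lborel (\<lambda>x. indicator (ball 0 q) x * (norm x ^ k * g x))"
    if [measurable]: "g \<in> borel_measurable borel" and g: "\<And>x. \<bar>g x\<bar> \<le> C'" and q: "q \<le> 1"
    for g :: "real ^ 'n \<Rightarrow> real" and C' q :: real and k :: nat
  proof (rule Bochner_Integration.integrable_bound)
    show "integrable lborel (\<lambda>x::real^'n. C' * indicator (ball 0 q) x :: real)" by (intro integrable_mult_right ind)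
    have "\<bar>norm x ^ k * g x\<bar> \<le> 1 * C'" if "norm x < q" for x
      unfolding abs_mult using that q g by (intro mult_mono) (auto intro!: power_le_one)
    then show "AE x in lborel. norm (indicator (ball 0 q) x * (norm x ^ k * g x)) \<le> norm (C' * indicator (ball 0 q) x :: real)"
      by (intro AE_I2) (auto simp: indicator_def intro: order_trans[OF _ abs_ge_self])
  qed measurable
  have scale: "(LINT x|lborel. indicator (ball 0 q) x * (norm x ^ k * g x)) = q ^ (?n + k) * J k g"
    if [measurable]: "g \<in> borel_measurable borel" and g: "\<And>c x. c > 0 \<Longrightarrow> g (c *\<^sub>R x) = g x" and q: "q > 0"
    for g :: "real ^ 'n \<Rightarrow> real" and q :: real and k :: nat
  proof -
    have "(\<lambda>x. indicator (ball 0 q) x * (norm x ^ k * g x)) \<in> borel_measurable borel" by measurable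
    from integral_lborel_scaleR[OF this q]
    have "(LINT x|lborel. indicator (ball 0 q) x * (norm x ^ k * g x)) =
        q ^ ?n * (LINT x|lborel. indicator (ball 0 q) (q *\<^sub>R x) * (norm (q *\<^sub>R x) ^ k * g (q *\<^sub>R x)))"
      by simp
    also have "(\<lambda>x. indicator (ball 0 q) (q *\<^sub>R x) * (norm (q *\<^sub>R x) ^ k * g (q *\<^sub>R x))) =
        (\<lambda>x. q ^ k * (indicator (ball 0 1) x * (norm x ^ k * g x)))"
      using q by (auto simp: fun_eq_iff g power_mult_distrib indicator_def)
    finally show ?thesis by (simp add: J_def power_add)
  qed
  have J0: "J 0 (\<lambda>_. 1) = v" unfolding J_def v_def unit_vol_def by simp
  have ineq: "\<bar>(1 - q ^ (?n + k)) * J k h - (1 - q ^ ?n) * J 0 h\<bar> \<le> (1 - q ^ k) * (C * ((1 - q ^ ?n) * v))"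
    if q: "0 < q" "q < 1" for q
  proof -
    let ?i = "\<lambda>q x. indicator (ball (0::real^'n) q) x :: real"
    have i: "integrable lborel (\<lambda>x. ?i 1 x * (norm x ^ m * h x))"
      "integrable lborel (\<lambda>x. ?i q x * (norm x ^ m * h x))" for m
      using int[OF h bound, of 1 m] int[OF h bound, of q m] q by simp_all
    have sc: "(LINT x|lborel. ?i q x * (norm x ^ m * h x)) = q ^ (?n + m) * J m h" for m
      by (rule scale) (use q hom in auto)
    \<comment> \<open>the integral over the shell between the radii \<open>q\<close> and \<open>1\<close>\<close>
    have shell: "(1 - q ^ (?n + m)) * J m h =
        (LINT x|lborel. ?i 1 x * (norm x ^ m * h x) - ?i q x * (norm x ^ m * h x))" for m
      unfolding Bochner_Integration.integral_diff[OF i] sc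
      by (simp add: J_def left_diff_distrib)
    note a = shell[of k] and b = shell[of 0, unfolded add_0_right]
    have c: "(1 - q ^ ?n) * v = (LINT x|lborel. ?i 1 x - ?i q x)"
      unfolding Bochner_Integration.integral_diff[OF ind ind]
      using scale[of "\<lambda>_. 1" q 0] q by (simp add: J0 left_diff_distrib unit_vol_def v_def)
    have diff: "(1 - q ^ (?n + k)) * J k h - (1 - q ^ ?n) * J 0 h =
        (LINT x|lborel. (?i 1 x * (norm x ^ k * h x) - ?i q x * (norm x ^ k * h x)) -
           (?i 1 x * (norm x ^ 0 * h x) - ?i q x * (norm x ^ 0 * h x)))"
      unfolding a b
      by (rule Bochner_Integration.integral_diff[symmetric]) (intro Bochner_Integration.integrable_diff i)+
    have "\<bar>(1 - q ^ (?n + k)) * J k h - (1 - q ^ ?n) * J 0 h\<bar> \<le> (LINT x|lborel. (1 - q ^ k) * (C * (?i 1 x - ?i q x)))"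
      unfolding diff
    proof (rule integral_abs_bound_integral)
      fix x :: "real ^ 'n"
      have "\<bar>norm x ^ k * h x - h x\<bar> \<le> (1 - q ^ k) * C" if "norm x < 1" "norm x \<ge> q"
      proof -
        have "norm x ^ k * h x - h x = (norm x ^ k - 1) * h x" by (simp add: algebra_simps)
        moreover have "\<bar>norm x ^ k - 1\<bar> \<le> 1 - q ^ k"
          using power_mono[of q "norm x" k] power_le_one[of "norm x" k] that q by auto
        ultimately show ?thesis
          using bound[of x] by (simp add: abs_mult mult_mono)
      qed
      then show "\<bar>(?i 1 x * (norm x ^ k * h x) - ?i q x * (norm x ^ k * h x)) -
           (?i 1 x * (norm x ^ 0 * h x) - ?i q x * (norm x ^ 0 * h x))\<bar> \<le> (1 - q ^ k) * (C * (?i 1 x - ?i q x))"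
        using q by (cases "norm x < q"; cases "norm x < 1") auto
    qed (intro Bochner_Integration.integrable_diff integrable_mult_right i ind)+
    also have "\<dots> = (1 - q ^ k) * (C * ((1 - q ^ ?n) * v))"
      unfolding c by (simp only: Bochner_Integration.integral_mult_right_zero)
    finally show ?thesis .
  qed
  \<comment> \<open>\<open>(1 - q ^ m) / (1 - q)\<close>, which tends to \<open>m\<close>\<close>
  define a where "a m q = (\<Sum>i<m. q ^ i)" for m :: nat and q :: real
  have ineq': "\<bar>a (?n + k) q * J k h - a ?n q * J 0 h\<bar> \<le> (1 - q ^ k) * (C * (a ?n q * v))"
    if q: "0 < q" "q < 1" for q
  proof -
    have eq: "1 - q ^ m = (1 - q) * a m q" for m unfolding a_def by (rule one_diff_power_eq)
    have abs_eq: "(1 - q) * \<bar>a (?n + k) q * J k h - a ?n q * J 0 h\<bar> =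
        \<bar>(1 - q) * (a (?n + k) q * J k h - a ?n q * J 0 h)\<bar>"
      using q by (simp add: abs_mult)
    have shells: "(1 - q) * (a (?n + k) q * J k h - a ?n q * J 0 h) =
        (1 - q ^ (?n + k)) * J k h - (1 - q ^ ?n) * J 0 h"
      unfolding eq by (simp only: right_diff_distrib mult.assoc)
    have "(1 - q) * \<bar>a (?n + k) q * J k h - a ?n q * J 0 h\<bar> \<le> (1 - q ^ k) * (C * ((1 - q ^ ?n) * v))"
      unfolding abs_eq shells by (rule ineq[OF q])
    also have "\<dots> = (1 - q) * ((1 - q ^ k) * (C * (a ?n q * v)))"
      unfolding eq[of ?n] by (simp only: mult_ac)
    finally show ?thesis using q by simp
  qed
  have a_lim: "(a m \<longlongrightarrow> real m) (at_left 1)" for m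
  proof -
    have "(a m \<longlongrightarrow> a m 1) (at_left 1)" unfolding a_def by (intro tendsto_intros)
    then show ?thesis by (simp add: a_def)
  qed
  have pow_lim: "((\<lambda>q::real. 1 - q ^ k) \<longlongrightarrow> 1 - 1 ^ k) (at_left 1)" by (intro tendsto_intros)
  have "((\<lambda>q. (1 - q ^ k) * (C * (a ?n q * v))) \<longlongrightarrow> (1 - 1 ^ k) * (C * (real ?n * v))) (at_left 1)"
    by (intro tendsto_mult tendsto_const pow_lim a_lim)
  moreover have "((\<lambda>q. \<bar>a (?n + k) q * J k h - a ?n q * J 0 h\<bar>) \<longlongrightarrow>
      \<bar>real (?n + k) * J k h - real ?n * J 0 h\<bar>) (at_left 1)"
    by (intro tendsto_rabs tendsto_diff tendsto_mult tendsto_const a_lim)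
  moreover have "eventually (\<lambda>q. \<bar>a (?n + k) q * J k h - a ?n q * J 0 h\<bar> \<le> (1 - q ^ k) * (C * (a ?n q * v))) (at_left 1)"
    using eventually_at_left_real[OF zero_less_one] by (rule eventually_mono) (auto intro: ineq')
  ultimately have "\<bar>real (?n + k) * J k h - real ?n * J 0 h\<bar> \<le> (1 - 1 ^ k) * (C * (real ?n * v))"
    by (intro tendsto_le[OF trivial_limit_at_left_real])
  then show ?thesis by (simp add: J_def)
qed

lemma continuous_hom_polys: "p \<in> hom_polys l \<Longrightarrow> continuous_on A p"
  by (simp add: continuous_on_polymonial_function real_polynomial_function_hom_polys
      flip: real_polynomial_function_eq)

lemma measurable_hom_polys: "p \<in> hom_polys l \<Longrightarrow> p \<in> borel_measurable borel"
  by (intro borel_measurable_continuous_onI continuous_hom_polys)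

text \<open>
  The weight \<open>1 - (norm x)\<^sup>2\<close> is a difference of two powers of the norm, so \<open>radial_moment\<close>
  applies after the factor \<open>norm x ^ m\<close> has been split off from \<open>p\<close>. The constant \<open>\<kappa>\<close> is the
  difference of the two radial factors times the volume of the unit ball.
\<close>

lemma integral_weight_hom_polys:
  assumes p: "p \<in> hom_polys m"
  obtains \<kappa> where "\<kappa> > 0"
    "(LINT x|lborel. max 0 (1 - (norm x)\<^sup>2) * p x) = \<kappa> * (LINT x|sphere_measure. p x)"
proof -
  let ?n = "CARD('a)"
  let ?B = "ball 0 1 :: (real ^ 'a) set"
  define h where "h x = p (x /\<^sub>R norm x)" for x
  have [measurable]: "p \<in> borel_measurable borel" by (rule measurable_hom_polys[OF p])
  have hm[measurable]: "h \<in> borel_measurable borel" unfolding h_def by measurable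
  have B[measurable]: "?B \<in> sets borel" by simp
  obtain C where C: "\<And>x. \<bar>h x\<bar> \<le> C"
  proof -
    have "compact (p ` cball 0 1)" by (intro compact_continuous_image continuous_hom_polys[OF p]) auto
    then obtain C where "\<And>x. x \<in> cball 0 1 \<Longrightarrow> \<bar>p x\<bar> \<le> C"
      using compact_imp_bounded bounded_iff by (metis image_eqI real_norm_def)
    then have "\<bar>h x\<bar> \<le> C" for x unfolding h_def by (cases "x = 0") auto
    then show ?thesis using that by blast
  qed
  have hom: "h (c *\<^sub>R x) = h x" if "c > 0" for c x
  proof -
    have "(c *\<^sub>R x) /\<^sub>R norm (c *\<^sub>R x) = x /\<^sub>R norm x" using that by (simp add: field_simps)
    then show ?thesis by (simp only: h_def)
  qed
  \<comment> \<open>the polar decomposition of \<open>p\<close>; it also holds at the origin, where \<open>h 0 = p 0\<close>\<close>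
  have ph: "p x = norm x ^ m * h x" for x
    using hom_polys_scaleR[OF p, of "norm x" "x /\<^sub>R norm x"] by (cases "x = 0") (simp_all add: h_def)
  define J where "J k = (LINT x|lborel. indicator ?B x * (norm x ^ k * h x))" for k
  define \<kappa> where "\<kappa> = (real ?n / real (?n + m) - real ?n / real (?n + (m + 2))) * unit_vol TYPE('a)"
  have J: "J k = real ?n / real (?n + k) * J 0" for k
  proof -
    have "real (?n + k) * J k = real ?n * (LINT x|lborel. indicator ?B x * h x)"
      unfolding J_def by (rule radial_moment[OF hm C]) (rule hom)
    moreover have "real (?n + k) > 0" using zero_less_card_finite[where 'a='a] by linarith
    ultimately show ?thesis by (simp add: J_def nonzero_eq_divide_eq mult.commute)
  qed
  have int: "integrable lborel (\<lambda>x. indicator ?B x * (norm x ^ k * h x))" for k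
  proof (rule Bochner_Integration.integrable_bound)
    show "integrable lborel (\<lambda>x. C * indicator ?B x :: real)"
      using emeasure_lborel_ball_finite[of "0::real^'a" 1]
      by (intro integrable_mult_right integrable_real_indicator) auto
    have "\<bar>norm x ^ k * h x\<bar> \<le> 1 * C" if "norm x < 1" for x
      unfolding abs_mult using that C by (intro mult_mono) (auto intro!: power_le_one)
    then show "AE x in lborel. norm (indicator ?B x * (norm x ^ k * h x)) \<le> norm (C * indicator ?B x :: real)"
      by (intro AE_I2) (auto simp: indicator_def intro: order_trans[OF _ abs_ge_self])
  qed measurable
  have "max 0 (1 - (norm x)\<^sup>2) * p x =
      indicator ?B x * (norm x ^ m * h x) - indicator ?B x * (norm x ^ (m + 2) * h x)" for x
  proof (cases "norm x < 1")
    case True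
    then have "(norm x)\<^sup>2 \<le> 1" by (simp add: power_le_one)
    then show ?thesis using True ph[of x] by (simp add: max_def algebra_simps power2_eq_square)
  next
    case False
    then have "max 0 (1 - (norm x)\<^sup>2) = 0" using one_le_power[of "norm x" 2] by simp
    then show ?thesis using False by simp
  qed
  then have "(LINT x|lborel. max 0 (1 - (norm x)\<^sup>2) * p x) = J m - J (m + 2)"
    unfolding J_def Bochner_Integration.integral_diff[OF int int, symmetric] by (simp only:)
  also have "\<dots> = (real ?n / real (?n + m) - real ?n / real (?n + (m + 2))) * J 0"
    by (subst (1 2) J) (simp add: algebra_simps)
  also have "J 0 = unit_vol TYPE('a) * (LINT x|sphere_measure. p x)"
    using unit_vol_pos[where 'n='a] by (simp add: integral_sphere_measure J_def h_def)
  finally have "(LINT x|lborel. max 0 (1 - (norm x)\<^sup>2) * p x) = \<kappa> * (LINT x|sphere_measure. p x)"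
    by (simp add: \<kappa>_def)
  moreover have "\<kappa> > 0"
  proof -
    have n: "real ?n > 0" by simp
    have "real ?n / real (?n + (m + 2)) < real ?n / real (?n + m)"
      by (rule divide_strict_left_mono[OF _ n mult_pos_pos]) (use n in linarith)+
    then show ?thesis using unit_vol_pos[where 'n='a] by (simp add: \<kappa>_def)
  qed
  ultimately show ?thesis using that by blast
qed

section \<open>Orthogonality of harmonics of different degree\<close>

text \<open>
  The partial derivatives are again polynomials, so the statement can be applied to them once
  more.
\<close>

lemma polynomial_gradient:
  fixes p :: "real ^ 'n \<Rightarrow> real"
  assumes "real_polynomial_function p"
  shows "\<exists>D. (\<forall>i. real_polynomial_function (D i)) \<and>
             (\<forall>x. (p has_derivative (\<lambda>h. \<Sum>i\<in>UNIV. h $ i * D i x)) (at x))"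
  using assms
proof (induction rule: real_polynomial_function.induct)
  case (linear f)
  have "f h = (\<Sum>i\<in>UNIV. h $ i * f (axis i 1))" for h
  proof -
    have "f h = f (\<Sum>i\<in>UNIV. h $ i *\<^sub>R axis i 1)"
      using basis_expansion[of h] by (simp add: scalar_mult_eq_scaleR)
    also have "\<dots> = (\<Sum>i\<in>UNIV. h $ i * f (axis i 1))"
      using bounded_linear.linear[OF linear] by (simp add: linear_sum linear_cmul)
    finally show ?thesis .
  qed
  then have "f = (\<lambda>h. \<Sum>i\<in>UNIV. h $ i * f (axis i 1))" by blast
  moreover have "(f has_derivative f) (at x)" for x
    by (rule bounded_linear_imp_has_derivative[OF linear])
  ultimately show ?case
    by (intro exI[of _ "\<lambda>i x. f (axis i 1)"]) (auto intro: real_polynomial_function.intros(2))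
next
  case (const c)
  show ?case
    by (intro exI[of _ "\<lambda>i x. 0"]) (auto intro: real_polynomial_function.intros(2))
next
  case (add f g)
  from add.IH(1) obtain D where D': "(\<forall>i. real_polynomial_function (D i)) \<and>
      (\<forall>x. (f has_derivative (\<lambda>h. \<Sum>i\<in>UNIV. h $ i * D i x)) (at x))" by (rule exE)
  from add.IH(2) obtain E where E': "(\<forall>i. real_polynomial_function (E i)) \<and>
      (\<forall>x. (g has_derivative (\<lambda>h. \<Sum>i\<in>UNIV. h $ i * E i x)) (at x))" by (rule exE)
  note D = D'[THEN conjunct1, THEN spec] D'[THEN conjunct2, THEN spec]
    and E = E'[THEN conjunct1, THEN spec] E'[THEN conjunct2, THEN spec]
  have "((\<lambda>x. f x + g x) has_derivative (\<lambda>h. \<Sum>i\<in>UNIV. h $ i * (D i x + E i x))) (at x)" for x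
    using has_derivative_add[OF D(2)[of x] E(2)[of x]] by (simp add: sum.distrib distrib_left)
  then show ?case
    using real_polynomial_function.intros(3)[OF D(1) E(1)] by (intro exI[of _ "\<lambda>i x. D i x + E i x"]) blast
next
  case (mult f g)
  from mult.IH(1) obtain D where D': "(\<forall>i. real_polynomial_function (D i)) \<and>
      (\<forall>x. (f has_derivative (\<lambda>h. \<Sum>i\<in>UNIV. h $ i * D i x)) (at x))" by (rule exE)
  from mult.IH(2) obtain E where E': "(\<forall>i. real_polynomial_function (E i)) \<and>
      (\<forall>x. (g has_derivative (\<lambda>h. \<Sum>i\<in>UNIV. h $ i * E i x)) (at x))" by (rule exE)
  note D = D'[THEN conjunct1, THEN spec] D'[THEN conjunct2, THEN spec]
    and E = E'[THEN conjunct1, THEN spec] E'[THEN conjunct2, THEN spec]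
  have "((\<lambda>x. f x * g x) has_derivative (\<lambda>h. \<Sum>i\<in>UNIV. h $ i * (f x * E i x + D i x * g x))) (at x)" for x
    using has_derivative_mult[OF D(2)[of x] E(2)[of x]]
    by (simp add: sum.distrib distrib_left sum_distrib_left sum_distrib_right mult_ac)
  moreover have "real_polynomial_function (\<lambda>x. f x * E i x + D i x * g x)" for i
    by (intro real_polynomial_function.intros(3,4) D E mult)
  ultimately show ?case by (intro exI[of _ "\<lambda>i x. f x * E i x + D i x * g x"]) blast
qed

lemma has_real_derivative_along_axis:
  fixes p :: "real ^ 'n \<Rightarrow> real"
  assumes "\<And>x. (p has_derivative (\<lambda>h. \<Sum>i\<in>UNIV. h $ i * D i x)) (at x)"
  shows "((\<lambda>t. p (x + t *\<^sub>R axis i 1)) has_real_derivative D i (x + t *\<^sub>R axis i 1)) (at t)"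
proof -
  let ?v = "axis i 1 :: real ^ 'n"
  have "((\<lambda>t. x + t *\<^sub>R ?v) has_derivative (\<lambda>s. s *\<^sub>R ?v)) (at t)"
    by (auto intro!: derivative_eq_intros)
  from has_derivative_compose[OF this assms]
  have "((\<lambda>t. p (x + t *\<^sub>R ?v)) has_derivative
      (\<lambda>s. \<Sum>j\<in>UNIV. (s *\<^sub>R ?v) $ j * D j (x + t *\<^sub>R ?v))) (at t)" .
  moreover have "(\<Sum>j\<in>UNIV. (s *\<^sub>R ?v) $ j * D j y) = D i y * s" for s y
  proof -
    have "(\<Sum>j\<in>UNIV. (s *\<^sub>R ?v) $ j * D j y) = (\<Sum>j\<in>UNIV. if j = i then D i y * s else 0)"
      by (intro sum.cong) (auto simp: axis_def)
    then show ?thesis by simp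
  qed
  ultimately show ?thesis by (simp add: has_field_derivative_def mult_commute_abs)
qed

lemma laplacian_eq_sum_second_derivatives:
  fixes p :: "real ^ 'n \<Rightarrow> real"
  assumes D: "\<And>x. (p has_derivative (\<lambda>h. \<Sum>i\<in>UNIV. h $ i * D i x)) (at x)"
    and DD: "\<And>i x. (D i has_derivative (\<lambda>h. \<Sum>j\<in>UNIV. h $ j * DD i j x)) (at x)"
  shows "laplacian p x = (\<Sum>i\<in>UNIV. DD i i x)"
  unfolding laplacian_def
proof (rule sum.cong[OF refl])
  fix i
  have "deriv (\<lambda>t. p (x + t *\<^sub>R axis i 1)) = (\<lambda>t. D i (x + t *\<^sub>R axis i 1))"
    by (intro ext DERIV_imp_deriv has_real_derivative_along_axis D)
  moreover have "deriv (\<lambda>t. D i (x + t *\<^sub>R axis i 1)) 0 = DD i i (x + 0 *\<^sub>R axis i 1)"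
    by (intro DERIV_imp_deriv has_real_derivative_along_axis DD)
  ultimately show "(deriv ^^ 2) (\<lambda>t. p (x + t *\<^sub>R axis i 1)) 0 = DD i i x"
    by (simp add: numeral_2_eq_2)
qed

lemma euler_homogeneous:
  fixes p :: "real ^ 'n \<Rightarrow> real"
  assumes p: "p \<in> hom_polys l"
    and D: "\<And>x. (p has_derivative (\<lambda>h. \<Sum>i\<in>UNIV. h $ i * D i x)) (at x)"
  shows "(\<Sum>i\<in>UNIV. x $ i * D i x) = real l * p x"
proof -
  have "((\<lambda>c. c *\<^sub>R x) has_derivative (\<lambda>s. s *\<^sub>R x)) (at 1)"
    by (auto intro!: derivative_eq_intros)
  from has_derivative_compose[OF this D]
  have "((\<lambda>c. p (c *\<^sub>R x)) has_derivative (\<lambda>s. \<Sum>i\<in>UNIV. (s *\<^sub>R x) $ i * D i (1 *\<^sub>R x))) (at 1)" .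
  then have "((\<lambda>c. p (c *\<^sub>R x)) has_real_derivative (\<Sum>i\<in>UNIV. x $ i * D i x)) (at 1)"
    unfolding has_field_derivative_def
    by (rule has_derivative_eq_rhs) (simp add: fun_eq_iff sum_distrib_left mult_ac)
  moreover have "((\<lambda>c. c ^ l * p x) has_real_derivative real l * p x) (at 1)"
    by (auto intro!: derivative_eq_intros)
  ultimately show ?thesis
    unfolding hom_polys_scaleR[OF p] by (rule DERIV_unique)
qed

text \<open>
  Squaring smooths the corner of the positive part at \<open>0\<close>.
\<close>

lemma has_real_derivative_pos_part_square:
  "((\<lambda>s::real. (max 0 s)\<^sup>2) has_real_derivative 2 * max 0 s) (at s)"
proof (cases s "0::real" rule: linorder_cases)
  case less
  have "((\<lambda>_. 0) has_real_derivative 2 * max 0 s) (at s)" using less by simp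
  moreover have "eventually (\<lambda>t. t < 0) (nhds s)" using less by (rule order_tendstoD(2)[OF filterlim_ident])
  then have "eventually (\<lambda>t. (max 0 t)\<^sup>2 = 0) (nhds s)" by eventually_elim simp
  ultimately show ?thesis using DERIV_cong_ev[of s s "\<lambda>t. (max 0 t)\<^sup>2" "\<lambda>_. 0", OF refl _ refl] by simp
next
  case equal
  have "((\<lambda>h. \<bar>h\<bar>) \<longlongrightarrow> \<bar>0::real\<bar>) (at 0)" by (intro tendsto_intros)
  then have lim: "((\<lambda>h. \<bar>h\<bar>) \<longlongrightarrow> (0::real)) (at 0)" by simp
  have bound: "norm ((max 0 h)\<^sup>2 / h) \<le> \<bar>h\<bar>" for h :: real
    by (cases "h > 0") (simp_all add: power2_eq_square)
  have "((\<lambda>h. (max 0 h)\<^sup>2 / h) \<longlongrightarrow> (0::real)) (at 0)"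
    by (rule Lim_null_comparison[OF _ lim]) (rule always_eventually, rule allI, rule bound)
  then show ?thesis using equal by (simp add: DERIV_def)
next
  case greater
  have "((\<lambda>s. s\<^sup>2) has_real_derivative 2 * max 0 s) (at s)"
    using greater by (auto intro!: derivative_eq_intros)
  moreover have "eventually (\<lambda>t. t > 0) (nhds s)" using greater by (rule order_tendstoD(1)[OF filterlim_ident])
  then have "eventually (\<lambda>t. (max 0 t)\<^sup>2 = t\<^sup>2) (nhds s)" by eventually_elim simp
  ultimately show ?thesis using DERIV_cong_ev[of s s "\<lambda>t. (max 0 t)\<^sup>2" "\<lambda>s. s\<^sup>2", OF refl _ refl] by simp
qed

lemma has_real_derivative_weight:
  fixes x :: "real ^ 'n"
  shows "((\<lambda>t. (max 0 (1 - (norm (x + t *\<^sub>R axis i 1))\<^sup>2))\<^sup>2) has_real_derivative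
     - 4 * max 0 (1 - (norm (x + t *\<^sub>R axis i 1))\<^sup>2) * (x + t *\<^sub>R axis i 1) $ i) (at t)"
proof -
  have n: "(norm (x + t *\<^sub>R axis i 1))\<^sup>2 = (norm x)\<^sup>2 + 2 * t * x $ i + t\<^sup>2" for t
    unfolding power2_norm_eq_inner
    by (simp add: inner_add_left inner_add_right inner_axis inner_axis' power2_eq_square algebra_simps)
  have "((\<lambda>t. 1 - (norm (x + t *\<^sub>R axis i 1))\<^sup>2) has_real_derivative - 2 * (x + t *\<^sub>R axis i 1) $ i) (at t)"
    unfolding n by (auto intro!: derivative_eq_intros simp: axis_def)
  from DERIV_chain2[OF has_real_derivative_pos_part_square this]
  show ?thesis by (rule DERIV_cong) (simp add: left_diff_distrib distrib_left distrib_right mult_ac)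
qed

text \<open>
  Green's identity for \<open>p\<close> and \<open>q\<close>, with the unit ball replaced by the weight \<open>u\<^sup>2\<close>, which is
  continuously differentiable on the whole space and vanishes outside the ball, so that no
  boundary term appears. The mixed products of first derivatives cancel in the divergence of
  \<open>u\<^sup>2 * (p * grad q - q * grad p)\<close>, the second derivatives disappear because \<open>p\<close> and \<open>q\<close> are
  harmonic, and the gradient of \<open>u\<^sup>2\<close> is \<open>- 4 * u * x\<close>. The Euler identity turns what is left
  into \<open>4 * (l - m) * u * p * q\<close>.
\<close>

lemma harmonic_orthogonal_degrees:
  fixes p q :: "real ^ 'n \<Rightarrow> real"
  assumes p: "p \<in> hom_polys l" "\<And>x. laplacian p x = 0"
    and q: "q \<in> hom_polys m" "\<And>x. laplacian q x = 0"
    and "l \<noteq> m"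
  shows "(LINT x|sphere_measure. p x * q x) = 0"
proof -
  obtain D where D: "\<And>i. real_polynomial_function (D i)"
    "\<And>x. (p has_derivative (\<lambda>h. \<Sum>i\<in>UNIV. h $ i * D i x)) (at x)"
    using polynomial_gradient[OF real_polynomial_function_hom_polys[OF p(1)]] by blast
  obtain E where E: "\<And>i. real_polynomial_function (E i)"
    "\<And>x. (q has_derivative (\<lambda>h. \<Sum>i\<in>UNIV. h $ i * E i x)) (at x)"
    using polynomial_gradient[OF real_polynomial_function_hom_polys[OF q(1)]] by blast
  have "\<forall>i. \<exists>DD. (\<forall>j. real_polynomial_function (DD j)) \<and>
      (\<forall>x. (D i has_derivative (\<lambda>h. \<Sum>j\<in>UNIV. h $ j * DD j x)) (at x))"
    using polynomial_gradient[OF D(1)] by (rule allI)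
  from choice[OF this] obtain DD where DD': "\<forall>i. (\<forall>j. real_polynomial_function (DD i j)) \<and>
      (\<forall>x. (D i has_derivative (\<lambda>h. \<Sum>j\<in>UNIV. h $ j * DD i j x)) (at x))" by (rule exE)
  have "\<forall>i. \<exists>EE. (\<forall>j. real_polynomial_function (EE j)) \<and>
      (\<forall>x. (E i has_derivative (\<lambda>h. \<Sum>j\<in>UNIV. h $ j * EE j x)) (at x))"
    using polynomial_gradient[OF E(1)] by (rule allI)
  from choice[OF this] obtain EE where EE': "\<forall>i. (\<forall>j. real_polynomial_function (EE i j)) \<and>
      (\<forall>x. (E i has_derivative (\<lambda>h. \<Sum>j\<in>UNIV. h $ j * EE i j x)) (at x))" by (rule exE)
  have DD: "\<And>i j. real_polynomial_function (DD i j)"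
      "\<And>i x. (D i has_derivative (\<lambda>h. \<Sum>j\<in>UNIV. h $ j * DD i j x)) (at x)" using DD' by simp_all
  have EE: "\<And>i j. real_polynomial_function (EE i j)"
      "\<And>i x. (E i has_derivative (\<lambda>h. \<Sum>j\<in>UNIV. h $ j * EE i j x)) (at x)" using EE' by simp_all
  have harm: "(\<Sum>i\<in>UNIV. DD i i x) = 0" "(\<Sum>i\<in>UNIV. EE i i x) = 0" for x
    using laplacian_eq_sum_second_derivatives[OF D(2) DD(2), of x]
      laplacian_eq_sum_second_derivatives[OF E(2) EE(2), of x] p(2) q(2) by simp_all
  note euler = euler_homogeneous[OF p(1) D(2)] euler_homogeneous[OF q(1) E(2)]
  have cont: "continuous_on UNIV f" if "real_polynomial_function f" for f :: "real ^ 'n \<Rightarrow> real"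
    using that by (simp add: continuous_on_polymonial_function flip: real_polynomial_function_eq)
  note pc = continuous_hom_polys[OF p(1)] and qc = continuous_hom_polys[OF q(1)]
  define u where "u x = max 0 (1 - (norm x)\<^sup>2)" for x :: "real ^ 'n"
  define F where "F i x = (u x)\<^sup>2 * (p x * E i x - q x * D i x)" for i x
  \<comment> \<open>the \<open>i\<close>-th partial derivative of \<open>F i\<close>\<close>
  define G where "G i x = - 4 * u x * x $ i * (p x * E i x - q x * D i x) +
      (u x)\<^sup>2 * (p x * EE i i x - q x * DD i i x)" for i x
  have u: "continuous_on UNIV u" unfolding u_def by (intro continuous_intros)
  have u0: "u x = 0" if "norm x \<ge> 1" for x
    using one_le_power[OF that, of 2] by (simp add: u_def)
  note conts = u pc qc cont[OF D(1)] cont[OF E(1)] cont[OF DD(1)] cont[OF EE(1)]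
  have contF: "continuous_on UNIV (F i)" for i unfolding F_def by (intro continuous_intros conts)
  have contG: "continuous_on UNIV (G i)" for i unfolding G_def by (intro continuous_intros conts)
  have deriv: "((\<lambda>t. F i (x + t *\<^sub>R axis i 1)) has_real_derivative G i (x + t *\<^sub>R axis i 1)) (at t)" for i x t
  proof -
    note d = has_real_derivative_along_axis[of p D, OF D(2), of x i t] has_real_derivative_along_axis[of q E, OF E(2), of x i t]
      has_real_derivative_along_axis[of "D i" "DD i", OF DD(2), of x i t] has_real_derivative_along_axis[of "E i" "EE i", OF EE(2), of x i t]
    have "((\<lambda>t. (u (x + t *\<^sub>R axis i 1))\<^sup>2) has_real_derivative
        - 4 * u (x + t *\<^sub>R axis i 1) * (x + t *\<^sub>R axis i 1) $ i) (at t)"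
      unfolding u_def by (rule has_real_derivative_weight)
    from DERIV_mult[OF this DERIV_diff[OF DERIV_mult[OF d(1) d(4)] DERIV_mult[OF d(2) d(3)]]]
    show ?thesis unfolding F_def by (rule DERIV_cong) (simp add: G_def algebra_simps)
  qed
  have int0: "(LINT x|lborel. G i x) = 0" for i
    by (rule integral_directional_derivative_zero[where F = "F i" and e = "axis i 1"])
       (use contF contG deriv in \<open>auto simp: F_def G_def u0\<close>)
  have intG: "integrable lborel (G i)" for i
    by (rule integrable_continuous_compact_support[where r = 1]) (use contG in \<open>auto simp: G_def u0\<close>)
  have "(\<Sum>i\<in>UNIV. G i x) = 4 * (real l - real m) * (u x * (p x * q x))" for x
  proof -
    have "(\<Sum>i\<in>UNIV. G i x) = - 4 * u x * (p x * (\<Sum>i\<in>UNIV. x $ i * E i x) - q x * (\<Sum>i\<in>UNIV. x $ i * D i x)) +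
      (u x)\<^sup>2 * (p x * (\<Sum>i\<in>UNIV. EE i i x) - q x * (\<Sum>i\<in>UNIV. DD i i x))"
      unfolding G_def sum.distrib sum_distrib_left sum_subtractf[symmetric]
      by (intro arg_cong2[where f = "(+)"] sum.cong) (simp_all add: algebra_simps)
    then show ?thesis unfolding harm euler by (simp add: algebra_simps)
  qed
  then have "4 * (real l - real m) * (LINT x|lborel. u x * (p x * q x)) = (LINT x|lborel. (\<Sum>i\<in>UNIV. G i x))"
    by simp
  also have "\<dots> = 0" using intG int0 by simp
  finally have zero: "(LINT x|lborel. u x * (p x * q x)) = 0" using \<open>l \<noteq> m\<close> by simp
  obtain \<kappa> where "\<kappa> > 0" "(LINT x|lborel. max 0 (1 - (norm x)\<^sup>2) * (p x * q x)) =
      \<kappa> * (LINT x|sphere_measure. p x * q x)"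
    using integral_weight_hom_polys[OF hom_polys_mult[OF p(1) q(1)]] by blast
  with zero show ?thesis by (simp add: u_def)
qed

section \<open>Continuous functions on the sphere\<close>

lemma measurable_sphere_measure:
  fixes f :: "real ^ 'n \<Rightarrow> real"
  assumes "continuous_on (sphere 0 1) f"
  shows "f \<in> borel_measurable sphere_measure"
proof -
  have "sets (sphere_measure :: (real ^ 'n) measure) = sets (restrict_space borel (sphere 0 1))"
    unfolding sphere_measure_def by (rule sets_restrict_space_cong) simp
  then have "borel_measurable sphere_measure =
      (borel_measurable (restrict_space borel (sphere 0 1)) :: (real ^ 'n \<Rightarrow> real) set)"
    by (rule measurable_cong_sets) simp
  then show ?thesis using borel_measurable_continuous_on_restrict[OF assms] by simp
qed

lemma integrable_sphere_measure:
  fixes f :: "real ^ 'n \<Rightarrow> real"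
  assumes "continuous_on (sphere 0 1) f"
  shows "integrable sphere_measure f"
proof -
  interpret prob_space "sphere_measure :: (real ^ 'n) measure" by (rule prob_space_sphere_measure)
  have "compact (f ` sphere 0 1)" by (intro compact_continuous_image assms compact_sphere)
  then obtain B where "\<And>x. x \<in> sphere 0 1 \<Longrightarrow> norm (f x) \<le> B"
    using compact_imp_bounded bounded_iff by (metis image_eqI)
  then show ?thesis
    by (intro integrable_const_bound[where B = B] AE_I2 measurable_sphere_measure assms) simp
qed

lemma continuous_sphere_polys:
  assumes "f \<in> sphere_polys l" shows "continuous_on (sphere 0 1) f"
proof -
  obtain p where p: "real_polynomial_function p" "f = on_sphere p" using sphere_polysE[OF assms] .
  have "continuous_on (sphere 0 1) p"
    using p by (simp add: continuous_on_polymonial_function flip: real_polynomial_function_eq)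
  then show ?thesis by (rule continuous_on_eq) (simp add: p on_sphere_def)
qed

lemma measurable_sphere_polys:
  assumes "f \<in> sphere_polys l" shows "f \<in> borel_measurable borel"
proof -
  obtain p where p: "real_polynomial_function p" "f = on_sphere p" using sphere_polysE[OF assms] .
  have "continuous_on UNIV p"
    using p by (simp add: continuous_on_polymonial_function flip: real_polynomial_function_eq)
  then have [measurable]: "p \<in> borel_measurable borel" by (rule borel_measurable_continuous_onI)
  show ?thesis unfolding p on_sphere_def by measurable
qed

lemma integral_sphere_sum_mult:
  fixes e :: "'i \<Rightarrow> real ^ 'n \<Rightarrow> real"
  assumes "\<And>i. i \<in> I \<Longrightarrow> continuous_on (sphere 0 1) (e i)" "continuous_on (sphere 0 1) g"
  shows "(LINT x|sphere_measure. (\<Sum>i\<in>I. c i * e i x) * g x) =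
         (\<Sum>i\<in>I. c i * (LINT x|sphere_measure. e i x * g x))"
proof -
  have "(LINT x|sphere_measure. (\<Sum>i\<in>I. c i * e i x) * g x) =
        (LINT x|sphere_measure. (\<Sum>i\<in>I. c i * (e i x * g x)))"
    by (simp add: sum_distrib_right mult.assoc)
  also have "\<dots> = (\<Sum>i\<in>I. LINT x|sphere_measure. c i * (e i x * g x))"
    by (intro Bochner_Integration.integral_sum integrable_sphere_measure
        continuous_on_mult continuous_on_const assms)
  also have "\<dots> = (\<Sum>i\<in>I. c i * (LINT x|sphere_measure. e i x * g x))" by simp
  finally show ?thesis .
qed

text \<open>
  The open cone over a nonempty relatively open subset of the sphere is open, so it contains a
  ball.
\<close>

lemma emeasure_sphere_open_pos:
  fixes T :: "(real ^ 'n) set"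
  assumes T: "open T" and x0: "x0 \<in> sphere 0 1" "x0 \<in> T"
  shows "emeasure sphere_measure (sphere 0 1 \<inter> T) > 0"
proof -
  let ?f = "\<lambda>x::real^'n. x /\<^sub>R norm x"
  let ?C = "(- {0} \<inter> ?f -` T) \<inter> ball 0 1"
  have "open (- {0} \<inter> ?f -` T)"
    by (rule continuous_open_preimage[OF _ _ T]) (auto intro!: continuous_intros)
  then have op: "open ?C" by auto
  have cone: "open_cone (sphere 0 1 \<inter> T) = ?C"
    by (subst open_cone_eq) auto
  have C: "(1/2) *\<^sub>R x0 \<in> ?C" using x0 by auto
  obtain r where r: "r > 0" "ball ((1/2) *\<^sub>R x0) r \<subseteq> ?C" by (rule openE[OF op C])
  have b: "0 < emeasure lborel (ball ((1/2) *\<^sub>R x0) r)"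
    using content_ball_pos[OF r(1), of "(1/2) *\<^sub>R x0"] by (auto simp: measure_def intro: zero_less_iff_neq_zero[THEN iffD2])
  have "emeasure lborel (ball ((1/2) *\<^sub>R x0) r) \<le> emeasure lborel ?C"
    using op by (intro emeasure_mono r) auto
  then have "0 < emeasure lborel ?C" by (rule less_le_trans[OF b])
  with cone show ?thesis
    using T emeasure_lborel_ball_finite[of "0::real^'n" 1]
    by (subst emeasure_sphere_measure) (auto simp: ennreal_zero_less_divide less_top)
qed

lemma AE_sphere_continuous_zero:
  fixes f :: "real ^ 'n \<Rightarrow> real"
  assumes f: "continuous_on (sphere 0 1) f" and ae: "AE x in sphere_measure. f x = 0"
    and x0: "x0 \<in> sphere 0 1"
  shows "f x0 = 0"
proof (rule ccontr)
  assume "f x0 \<noteq> 0"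
  from f have "\<forall>B. open B \<longrightarrow> (\<exists>A. open A \<and> A \<inter> sphere 0 1 = f -` B \<inter> sphere 0 1)"
    by (simp only: continuous_on_open_invariant)
  then have "open (- {0 :: real}) \<longrightarrow> (\<exists>A. open A \<and> A \<inter> sphere 0 1 = f -` (- {0}) \<inter> sphere 0 1)"
    by (rule spec)
  moreover have "open (- {0 :: real})" by (rule open_Compl) simp
  ultimately have "\<exists>A. open A \<and> A \<inter> sphere 0 1 = f -` (- {0}) \<inter> sphere 0 1" by (rule mp)
  then obtain T where "open T \<and> T \<inter> sphere 0 1 = f -` (- {0}) \<inter> sphere 0 1" by (rule exE)
  then have T: "open T" "T \<inter> sphere 0 1 = f -` (- {0}) \<inter> sphere 0 1" by (rule conjunct1, rule conjunct2)
  have "x0 \<in> T \<inter> sphere 0 1" unfolding T(2) using x0 \<open>f x0 \<noteq> 0\<close> by simp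
  then have "x0 \<in> T" by simp
  from emeasure_sphere_open_pos[OF T(1) x0 this]
  have pos: "emeasure sphere_measure (T \<inter> sphere 0 1) > 0" by (simp only: Int_commute)
  have eq: "T \<inter> sphere 0 1 = {x \<in> space sphere_measure. \<not> f x = 0}"
    unfolding T(2) by auto
  have "T \<inter> sphere 0 1 \<in> sets sphere_measure"
    using borel_open[OF T(1)] borel_closed[OF closed_sphere] by (simp add: sets_sphere_measure sets.Int)
  then have "T \<inter> sphere 0 1 \<in> null_sets sphere_measure"
    using iffD1[OF AE_iff_null ae] unfolding eq by simp
  then have "emeasure sphere_measure (T \<inter> sphere 0 1) = 0" by (rule null_setsD1)
  with pos show False by simp
qed

lemma sum_fun_eval: "(\<Sum>v\<in>A. g v) x = (\<Sum>v\<in>A. g v x)" for g :: "'i \<Rightarrow> 'a \<Rightarrow> real"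
  by (induction A rule: infinite_finite_induct) (simp_all add: zero_fun_def)

section \<open>Orthonormal families of polynomials on the sphere\<close>

text \<open>
  An orthonormal family is linearly independent. If it has as many members as a generating set
  of the space, the exchange lemma leaves no room for a further independent element, and
  orthonormality identifies the coefficients.
\<close>

lemma orthonormal_family_spans:
  fixes e :: "'i \<Rightarrow> real ^ 'n \<Rightarrow> real"
  assumes I: "finite I" and e: "\<And>i. i \<in> I \<Longrightarrow> e i \<in> sphere_polys l"
    and on: "\<And>i j. i \<in> I \<Longrightarrow> j \<in> I \<Longrightarrow> (LINT x|sphere_measure. e i x * e j x) = (if i = j then 1 else 0)"
    and card: "card (sphere_monomials l :: (real ^ 'n \<Rightarrow> real) set) \<le> card I"
    and f: "f \<in> sphere_polys l"
  shows "f x = (\<Sum>i\<in>I. (LINT y|sphere_measure. f y * e i y) * e i x)"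
proof -
  have ce: "continuous_on (sphere 0 1) (e i)" if "i \<in> I" for i
    using continuous_sphere_polys[OF e[OF that]] .
  have coeff: "(LINT x|sphere_measure. (\<Sum>i\<in>I. c i * e i x) * e j x) = c j" if "j \<in> I" for c j
    using that I by (simp add: integral_sphere_sum_mult ce on if_distrib cong: sum.cong if_cong)
  have inj: "inj_on e I"
  proof (rule inj_onI)
    fix i j assume "i \<in> I" "j \<in> I" "e i = e j"
    then show "i = j" using on[of i j] on[of i i] by (auto split: if_splits)
  qed
  have ind: "fun_space.independent (e ` I)"
  proof (rule fun_space.independent_if_scalars_zero)
    fix c v assume z: "(\<Sum>v\<in>e ` I. (\<lambda>x. c v * v x)) = 0" and "v \<in> e ` I"
    then obtain j where j: "j \<in> I" "v = e j" by auto
    have "(\<Sum>i\<in>I. c (e i) * e i x) = 0" for x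
      using fun_cong[OF z, of x] by (simp add: sum.reindex[OF inj] sum_fun_eval zero_fun_def)
    then show "c v = 0" using coeff[OF j(1), of "\<lambda>i. c (e i)"] j by simp
  qed (use I in simp)
  have sub: "e ` I \<subseteq> fun_space.span (sphere_monomials l)" using e by (auto simp: sphere_polys_def)
  have "f \<in> fun_space.span (e ` I)"
  proof (rule ccontr)
    assume "f \<notin> fun_space.span (e ` I)"
    then have ind': "fun_space.independent (insert f (e ` I))" and "f \<notin> e ` I"
      using ind by (auto simp: fun_space.independent_insert intro: fun_space.span_base)
    have "insert f (e ` I) \<subseteq> fun_space.span (sphere_monomials l)"
      using sub f by (simp add: sphere_polys_def)
    from fun_space.independent_span_bound[OF finite_sphere_monomials ind' this]
    have "card (insert f (e ` I)) \<le> card (sphere_monomials l :: (real ^ 'n \<Rightarrow> real) set)" ..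
    then show False using \<open>f \<notin> e ` I\<close> I card by (simp add: card_image[OF inj])
  qed
  then obtain u where "f = (\<Sum>v\<in>e ` I. (\<lambda>x. u v * v x))"
    using I by (auto simp: fun_space.span_finite)
  then have fx: "f x = (\<Sum>i\<in>I. u (e i) * e i x)" for x
    by (simp add: sum.reindex[OF inj] sum_fun_eval)
  then have "(LINT y|sphere_measure. f y * e j y) = u (e j)" if "j \<in> I" for j
    using coeff[OF that, of "\<lambda>i. u (e i)"] by simp
  then show ?thesis using fx by simp
qed

section \<open>Spherical harmonics as an orthonormal basis\<close>

locale sphere_harmonics =
  fixes d :: nat and Y :: "nat \<Rightarrow> nat \<Rightarrow> real ^ 'n \<Rightarrow> real"
  assumes dim: "CARD('n) = d + 1" "d \<ge> 2"
    and Y: "orthonormal_harmonics d Y"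
begin

abbreviation Z :: "nat \<Rightarrow> nat" where "Z \<equiv> harmonic_dim d"

lemma harmonic_extension:
  assumes "k \<in> {1..Z l}"
  obtains p where "p \<in> hom_polys l" "\<forall>x. laplacian p x = 0" "\<forall>x\<in>sphere 0 1. Y l k x = p x"
proof -
  have "spherical_harmonic l (Y l k)" using Y assms unfolding orthonormal_harmonics_def by blast
  then obtain p where "real_polynomial_function p" "\<forall>c x. p (c *\<^sub>R x) = c ^ l * p x"
    "\<forall>x. laplacian p x = 0" "\<forall>x\<in>sphere 0 1. Y l k x = p x"
    unfolding spherical_harmonic_def by blast
  then show ?thesis using that[of p] homogeneous_polynomial_in_hom_polys[of p l] by blast
qed

lemma on_sphere_Y: "k \<in> {1..Z l} \<Longrightarrow> on_sphere (Y l k) \<in> sphere_polys l"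
proof -
  assume "k \<in> {1..Z l}"
  then obtain p where p: "p \<in> hom_polys l" "\<forall>x\<in>sphere 0 1. Y l k x = p x"
    using harmonic_extension by blast
  have "on_sphere (Y l k) = on_sphere p" using p(2) by (auto simp: on_sphere_def)
  then show ?thesis using on_sphere_hom_polys[OF p(1), of l] by simp
qed

lemma continuous_Y: "k \<in> {1..Z l} \<Longrightarrow> continuous_on (sphere 0 1) (Y l k)"
  by (rule continuous_on_eq[OF continuous_sphere_polys[OF on_sphere_Y]]) (auto simp: on_sphere_def)

lemma orthonormal_Y:
  assumes "k \<in> {1..Z l}" "k' \<in> {1..Z l'}"
  shows "(LINT x|sphere_measure. Y l k x * Y l' k' x) = (if l = l' \<and> k = k' then 1 else 0)"
proof (cases "l = l'")
  case True
  then show ?thesis using Y assms unfolding orthonormal_harmonics_def by auto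
next
  case False
  obtain p where p: "p \<in> hom_polys l" "\<forall>x. laplacian p x = 0" "\<forall>x\<in>sphere 0 1. Y l k x = p x"
    by (rule harmonic_extension[OF assms(1)])
  obtain q where q: "q \<in> hom_polys l'" "\<forall>x. laplacian q x = 0" "\<forall>x\<in>sphere 0 1. Y l' k' x = q x"
    by (rule harmonic_extension[OF assms(2)])
  have "(LINT x|sphere_measure. Y l k x * Y l' k' x) = (LINT x|sphere_measure. p x * q x)"
    by (rule Bochner_Integration.integral_cong) (simp_all add: p q)
  then show ?thesis using harmonic_orthogonal_degrees[OF p(1) spec[OF p(2)] q(1) spec[OF q(2)] False] False by simp
qed

definition idx :: "nat \<Rightarrow> (nat \<times> nat) set" where
  "idx l = (SIGMA j:{..l}. {1..Z j})"

text \<open>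
  The values of \<open>Y\<close> off the sphere are arbitrary; extended by \<open>0\<close>, the harmonics are elements of
  \<open>sphere_polys\<close>.
\<close>

definition e :: "nat \<times> nat \<Rightarrow> real ^ 'n \<Rightarrow> real" where
  "e i = on_sphere (Y (fst i) (snd i))"

lemma finite_idx: "finite (idx l)"
  unfolding idx_def by auto

lemma e_sphere_polys: "i \<in> idx l \<Longrightarrow> e i \<in> sphere_polys l"
  using on_sphere_Y sphere_polys_mono by (fastforce simp: idx_def e_def)

lemma e_orthonormal:
  assumes "i \<in> idx l" "j \<in> idx l"
  shows "(LINT x|sphere_measure. e i x * e j x) = (if i = j then 1 else 0)"
proof -
  have "(LINT x|sphere_measure. e i x * e j x) =
      (LINT x|sphere_measure. Y (fst i) (snd i) x * Y (fst j) (snd j) x)"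
    by (rule Bochner_Integration.integral_cong) (simp_all add: e_def on_sphere_def)
  then show ?thesis using assms by (subst (asm) orthonormal_Y) (auto simp: idx_def)
qed

lemma sphere_polys_expansion:
  assumes "f \<in> sphere_polys l"
  shows "f x = (\<Sum>i\<in>idx l. (LINT y|sphere_measure. f y * e i y) * e i x)"
proof (rule orthonormal_family_spans[OF finite_idx e_sphere_polys e_orthonormal _ assms])
  show "card (sphere_monomials l :: (real ^ 'n \<Rightarrow> real) set) \<le> card (idx l)"
    using card_sphere_monomials[OF dim, of l] by (simp add: idx_def)
qed auto

lemma sphere_polys_parseval:
  assumes f: "f \<in> sphere_polys l"
  shows "(LINT x|sphere_measure. (f x)\<^sup>2) = (\<Sum>i\<in>idx l. (LINT y|sphere_measure. f y * e i y)\<^sup>2)"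
proof -
  have "(LINT x|sphere_measure. (f x)\<^sup>2) =
      (LINT x|sphere_measure. (\<Sum>i\<in>idx l. (LINT y|sphere_measure. f y * e i y) * e i x) * f x)"
    by (simp add: power2_eq_square flip: sphere_polys_expansion[OF f])
  also have "\<dots> = (\<Sum>i\<in>idx l. (LINT y|sphere_measure. f y * e i y) * (LINT x|sphere_measure. e i x * f x))"
    by (intro integral_sphere_sum_mult continuous_sphere_polys[OF e_sphere_polys] continuous_sphere_polys[OF f])
  finally show ?thesis by (simp add: power2_eq_square mult.commute)
qed

text \<open>
  The sum at \<open>x\<close> is the largest value of \<open>f x ^ 2\<close> over the \<open>f\<close> of norm at most \<open>1\<close> in the span
  of the harmonics of degree at most \<open>l\<close>. Let \<open>R\<close> be a rotation with \<open>R x = y\<close>. The reproducing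
  function \<open>g\<close> of the point \<open>y\<close> has norm squared and value at \<open>y\<close> both equal to the sum at \<open>y\<close>.
  Its rotation \<open>\<lambda>z. g (R z)\<close> lies in the same space, has the same norm and takes that value at
  \<open>x\<close>.
\<close>

lemma kernel_diagonal_le:
  assumes x: "norm x = 1" and y: "norm y = 1"
  shows "(\<Sum>i\<in>idx l. (e i y)\<^sup>2) \<le> (\<Sum>i\<in>idx l. (e i x)\<^sup>2)"
proof -
  let ?K = "\<lambda>x. \<Sum>i\<in>idx l. (e i x)\<^sup>2"
  obtain R where R: "orthogonal_transformation R" "R x = y"
    using orthogonal_transformation_exists_1[OF x y] .
  define g where "g z = (\<Sum>i\<in>idx l. e i y * e i z)" for z
  have g: "g \<in> sphere_polys l"
    unfolding g_def by (intro sphere_polys_sum sphere_polys_scale e_sphere_polys)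
  have gR: "(\<lambda>z. g (R z)) \<in> sphere_polys l" by (rule sphere_polys_orthogonal_transformation[OF R(1) g])
  have "(LINT z|sphere_measure. g z * e j z) = e j y" if "j \<in> idx l" for j
  proof -
    have "(LINT z|sphere_measure. g z * e j z) = (\<Sum>i\<in>idx l. e i y * (LINT z|sphere_measure. e i z * e j z))"
      unfolding g_def using that
      by (intro integral_sphere_sum_mult continuous_sphere_polys[OF e_sphere_polys])
    also have "\<dots> = (\<Sum>i\<in>idx l. if i = j then e j y else 0)"
      using that by (intro sum.cong) (auto simp: e_orthonormal)
    finally show ?thesis using that finite_idx by simp
  qed
  then have norm_g: "(LINT z|sphere_measure. (g z)\<^sup>2) = ?K y"
    by (simp add: sphere_polys_parseval[OF g])
  have [measurable]: "g \<in> borel_measurable borel" by (rule measurable_sphere_polys[OF g])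
  have "(g (R x))\<^sup>2 \<le> (\<Sum>i\<in>idx l. (LINT z|sphere_measure. g (R z) * e i z)\<^sup>2) * ?K x"
    by (subst sphere_polys_expansion[OF gR]) (rule Cauchy_Schwarz_ineq_sum)
  also have "(\<Sum>i\<in>idx l. (LINT z|sphere_measure. g (R z) * e i z)\<^sup>2) = (LINT z|sphere_measure. (g (R z))\<^sup>2)"
    by (simp add: sphere_polys_parseval[OF gR])
  also have "\<dots> = ?K y"
    using integral_sphere_orthogonal[OF _ R(1), of "\<lambda>z. (g z)\<^sup>2"] norm_g by simp
  also have "g (R x) = ?K y" by (simp add: g_def R(2) power2_eq_square)
  finally have "?K y * ?K y \<le> ?K y * ?K x" by (simp add: power2_eq_square)
  moreover have "?K y \<ge> 0" "?K x \<ge> 0" by (intro sum_nonneg; simp)+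
  ultimately show ?thesis by (cases "?K y = 0") (auto simp: mult_le_cancel_left)
qed

text \<open>
  The inequality is symmetric in the two points; the contribution of a single degree is the
  difference of the sums for \<open>l\<close> and \<open>l - 1\<close>.
\<close>

lemma kernel_diagonal_eq:
  assumes x: "norm x = 1" and y: "norm y = 1"
  shows "(\<Sum>k=1..Z l. (Y l k x)\<^sup>2) = (\<Sum>k=1..Z l. (Y l k y)\<^sup>2)"
proof -
  have sum_eq: "(\<Sum>i\<in>idx l. (e i z)\<^sup>2) = (\<Sum>j\<le>l. \<Sum>k=1..Z j. (Y j k z)\<^sup>2)" if "norm z = 1" for z l
    unfolding idx_def by (subst sum.Sigma) (auto simp: e_def on_sphere_def that case_prod_unfold)
  have "(\<Sum>j\<le>l. \<Sum>k=1..Z j. (Y j k x)\<^sup>2) = (\<Sum>j\<le>l. \<Sum>k=1..Z j. (Y j k y)\<^sup>2)" for l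
    using kernel_diagonal_le[OF x y, of l] kernel_diagonal_le[OF y x, of l]
    by (simp add: sum_eq x y)
  from this[of l] this[of "l - 1"] show ?thesis by (cases l) simp_all
qed

text \<open>
  The constant is identified by integration, since each of the summands has integral \<open>1\<close>.
\<close>

lemma addition_formula:
  assumes x: "norm x = 1"
  shows "(\<Sum>k=1..Z l. (Y l k x)\<^sup>2) = real (Z l)"
proof -
  interpret prob_space "sphere_measure :: (real ^ 'n) measure" by (rule prob_space_sphere_measure)
  have "(\<Sum>k=1..Z l. (Y l k x)\<^sup>2) = (LINT y|(sphere_measure :: (real ^ 'n) measure). (\<Sum>k=1..Z l. (Y l k x)\<^sup>2))"
    using prob_space by simp
  also have "\<dots> = (LINT y|sphere_measure. (\<Sum>k=1..Z l. (Y l k y)\<^sup>2))"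
    by (rule Bochner_Integration.integral_cong[OF refl]) (rule kernel_diagonal_eq[OF x], simp)
  also have "\<dots> = (\<Sum>k=1..Z l. LINT y|sphere_measure. (Y l k y)\<^sup>2)"
    by (intro Bochner_Integration.integral_sum integrable_sphere_measure continuous_intros continuous_Y)
  also have "\<dots> = (\<Sum>k=1..Z l. 1)"
    by (intro sum.cong) (simp_all add: power2_eq_square orthonormal_Y)
  finally show ?thesis by simp
qed

text \<open>
  A polynomial close to \<open>f\<close> is a combination of harmonics on the sphere and hence orthogonal to
  \<open>f\<close>. So the integral of \<open>f\<^sup>2\<close> equals that of \<open>f * (f - p)\<close>, which is arbitrarily small. A
  continuous function that vanishes almost everywhere vanishes everywhere because the measure
  charges every nonempty open set.
\<close>

lemma completeness:
  assumes f: "continuous_on (sphere 0 1) f"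
    and zero: "\<And>l k. k \<in> {1..Z l} \<Longrightarrow> (LINT x|sphere_measure. f x * Y l k x) = 0"
    and x: "norm x = 1"
  shows "f x = 0"
proof -
  interpret prob_space "sphere_measure :: (real ^ 'n) measure" by (rule prob_space_sphere_measure)
  define I where "I = (LINT x|sphere_measure. \<bar>f x\<bar>)"
  have f2: "integrable sphere_measure (\<lambda>x. (f x)\<^sup>2)"
    by (intro integrable_sphere_measure continuous_intros f)
  have le: "(LINT x|sphere_measure. (f x)\<^sup>2) \<le> \<epsilon> * I" if eps: "\<epsilon> > 0" for \<epsilon>
  proof -
    obtain p where p: "real_polynomial_function p" "\<And>x. x \<in> sphere 0 1 \<Longrightarrow> \<bar>f x - p x\<bar> < \<epsilon>"
      using Stone_Weierstrass_real_polynomial_function[OF compact_sphere f eps] by metis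
    obtain l where l: "on_sphere p \<in> sphere_polys l" using on_sphere_polynomial[OF p(1)] .
    have pc: "continuous_on (sphere 0 1) (on_sphere p)" by (rule continuous_sphere_polys[OF l])
    have "(LINT y|sphere_measure. e i y * f y) = 0" if "i \<in> idx l" for i
    proof -
      have "(LINT y|sphere_measure. e i y * f y) = (LINT y|sphere_measure. f y * Y (fst i) (snd i) y)"
        by (rule Bochner_Integration.integral_cong) (simp_all add: e_def on_sphere_def)
      then show ?thesis using zero that by (auto simp: idx_def)
    qed
    then have "(LINT y|sphere_measure. on_sphere p y * f y) = 0"
      by (subst sphere_polys_expansion[OF l])
        (simp add: integral_sphere_sum_mult continuous_sphere_polys[OF e_sphere_polys] f)
    moreover have "(LINT y|sphere_measure. (f y)\<^sup>2) - (LINT y|sphere_measure. on_sphere p y * f y) =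
        (LINT y|sphere_measure. (f y)\<^sup>2 - on_sphere p y * f y)"
      by (intro Bochner_Integration.integral_diff[symmetric] f2 integrable_sphere_measure continuous_intros pc f)
    moreover have "(LINT y|sphere_measure. (f y)\<^sup>2 - on_sphere p y * f y) \<le> (LINT y|sphere_measure. \<epsilon> * \<bar>f y\<bar>)"
    proof (rule integral_mono)
      fix y :: "real ^ 'n" assume "y \<in> space sphere_measure"
      then have y: "y \<in> sphere 0 1" by simp
      have "(f y)\<^sup>2 - on_sphere p y * f y = (f y - p y) * f y"
        using y by (simp add: on_sphere_def power2_eq_square algebra_simps)
      also have "\<dots> \<le> \<bar>f y - p y\<bar> * \<bar>f y\<bar>" using abs_ge_self[of "(f y - p y) * f y"] by (simp add: abs_mult)
      also have "\<dots> \<le> \<epsilon> * \<bar>f y\<bar>" using p(2)[OF y] by (intro mult_right_mono) auto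
      finally show "(f y)\<^sup>2 - on_sphere p y * f y \<le> \<epsilon> * \<bar>f y\<bar>" .
    qed (intro integrable_sphere_measure continuous_intros pc f)+
    ultimately show ?thesis by (simp add: I_def)
  qed
  have "I \<ge> 0" unfolding I_def by simp
  have "(LINT x|sphere_measure. (f x)\<^sup>2) \<le> 0"
  proof (rule field_le_epsilon)
    fix \<delta> :: real assume "\<delta> > 0"
    \<comment> \<open>the summand \<open>1\<close> guards against \<open>I = 0\<close>\<close>
    have "(LINT x|sphere_measure. (f x)\<^sup>2) \<le> \<delta> / (I + 1) * I"
      using \<open>\<delta> > 0\<close> \<open>I \<ge> 0\<close> by (intro le) auto
    also have "\<dots> \<le> \<delta>" using \<open>\<delta> > 0\<close> \<open>I \<ge> 0\<close> by (simp add: field_simps)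
    finally show "(LINT x|sphere_measure. (f x)\<^sup>2) \<le> 0 + \<delta>" by simp
  qed
  moreover have "(LINT x|sphere_measure. (f x)\<^sup>2) \<ge> 0" by simp
  ultimately have "(LINT x|sphere_measure. (f x)\<^sup>2) = 0" by simp
  then have "AE x in sphere_measure. (f x)\<^sup>2 = 0"
    using integral_nonneg_eq_0_iff_AE[OF f2] by simp
  then have "AE x in sphere_measure. f x = 0" by simp
  then show ?thesis by (rule AE_sphere_continuous_zero[OF f]) (use x in simp)
qed

end

section \<open>Growth of the dimensions and decay of the weights\<close>

lemma harmonic_dim_pos:
  assumes "d \<ge> 2" shows "harmonic_dim d l > 0"
proof -
  obtain e where d: "d = Suc (Suc e)" using assms by (metis add_2_eq_Suc le_Suc_ex)
  show ?thesis unfolding d harmonic_dim_binomial by (simp add: zero_less_binomial)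
qed

lemma harmonic_dim_0:
  assumes "d \<ge> 2" shows "harmonic_dim d 0 = 1"
proof -
  obtain e where d: "d = Suc (Suc e)" using assms by (metis add_2_eq_Suc le_Suc_ex)
  show ?thesis unfolding d harmonic_dim_binomial by (simp add: binomial_eq_0)
qed

lemma harmonic_dim_le:
  assumes "d \<ge> 2" shows "harmonic_dim d l \<le> 2 * (l + d) ^ (d - 1)"
proof -
  obtain e where d: "d = Suc (Suc e)" using assms by (metis add_2_eq_Suc le_Suc_ex)
  have le: "(n choose Suc e) \<le> (l + d) ^ Suc e" if "n \<le> l + d" for n
  proof -
    have "(n choose Suc e) * 1 \<le> (n choose Suc e) * fact (Suc e)"
      by (intro mult_left_mono) (auto simp: fact_ge_1 simp del: fact_Suc)
    also have "\<dots> \<le> n ^ Suc e" by (rule binomial_fact_pow)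
    also have "\<dots> \<le> (l + d) ^ Suc e" using that by (rule power_mono) simp
    finally show ?thesis by simp
  qed
  have "harmonic_dim d l = ((l + Suc e) choose Suc e) + ((l + e) choose Suc e)"
    unfolding d by (rule harmonic_dim_binomial)
  also have "\<dots> \<le> (l + d) ^ Suc e + (l + d) ^ Suc e" by (intro add_mono le) (simp_all add: d)
  finally show ?thesis by (simp add: d)
qed

text \<open>
  A lower bound of the order \<open>l\<^sup>2\<close> for the eigenvalues, in terms of the shifted degree \<open>l + d\<close>,
  for which \<open>harmonic_dim_le\<close> is a pure power.
\<close>

lemma lb_eigenvalue_ge:
  assumes "d \<ge> 2" shows "(real l + real d)\<^sup>2 \<le> 4 * (real d)\<^sup>2 * (1 + lb_eigenvalue d l)"
proof -
  have d: "real d \<ge> 2" using assms by simp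
  have a: "(real l)\<^sup>2 \<le> 4 * (real d)\<^sup>2 * (real l)\<^sup>2"
  proof -
    have "1 \<le> (real d)\<^sup>2" using d by (simp add: one_le_power)
    then show ?thesis using mult_right_mono[of 1 "4 * (real d)\<^sup>2" "(real l)\<^sup>2"] by simp
  qed
  have "2 * real d * 1 \<le> 4 * (real d)\<^sup>2 * (real d - 1)"
    unfolding power2_eq_square using d mult_mono[of 1 "2 * real d" 1 "real d - 1"]
      mult_left_mono[of 1 "(2 * real d) * (real d - 1)" "2 * real d"] by (simp add: mult_ac)
  then have b: "2 * real d * real l \<le> 4 * (real d)\<^sup>2 * (real d - 1) * real l"
    by (intro mult_right_mono) auto
  have "(real l + real d)\<^sup>2 = (real l)\<^sup>2 + 2 * real d * real l + (real d)\<^sup>2"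
    by (simp add: power2_eq_square algebra_simps)
  also have "\<dots> \<le> 4 * (real d)\<^sup>2 * (real l)\<^sup>2 + 4 * (real d)\<^sup>2 * (real d - 1) * real l + 4 * (real d)\<^sup>2"
    by (intro add_mono a b) simp
  also have "\<dots> = 4 * (real d)\<^sup>2 * (1 + lb_eigenvalue d l)"
    by (simp add: lb_eigenvalue_def power2_eq_square algebra_simps)
  finally show ?thesis .
qed

lemma lb_eigenvalue_nonneg: "d \<ge> 1 \<Longrightarrow> lb_eigenvalue d l \<ge> 0"
  by (simp add: lb_eigenvalue_def)

locale sobolev_kernel = sphere_harmonics d Y for d and Y :: "nat \<Rightarrow> nat \<Rightarrow> real ^ 'n \<Rightarrow> real" +
  fixes s :: real and a :: "nat \<Rightarrow> real"
  assumes s: "s > real d / 2"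
    and a_pos: "\<And>l. a l > 0"
    and a_asymp: "same_order a (\<lambda>l. (1 + lb_eigenvalue d l) powr (- s))"
begin

text \<open>
  The comparison of the sequences \<open>a\<close> and \<open>(1 + lb_eigenvalue d l) powr (- s)\<close> in the forms in
  which it is used: for the weights and for their reciprocals.
\<close>

lemma weight_bounds:
  obtains c1 c2 where "c1 > 0" "c2 > 0" "\<And>l. c1 * a l \<le> (1 + lb_eigenvalue d l) powr (- s)"
    "\<And>l. (1 + lb_eigenvalue d l) powr s \<le> 1 / c1 * (1 / a l)"
    "\<And>l. 1 / a l \<le> c2 * (1 + lb_eigenvalue d l) powr s"
proof -
  obtain c1 c2 where c: "c1 > 0" "c2 > 0" "\<And>n. c1 * a n \<le> (1 + lb_eigenvalue d n) powr (- s)"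
      "\<And>n. (1 + lb_eigenvalue d n) powr (- s) \<le> c2 * a n"
    using a_asymp unfolding same_order_def by blast
  have pos: "(1 + lb_eigenvalue d l) powr s > 0" for l
    using lb_eigenvalue_nonneg[of d l] dim by simp
  show ?thesis
  proof (rule that[of c1 c2])
    fix l
    show "(1 + lb_eigenvalue d l) powr s \<le> 1 / c1 * (1 / a l)"
      using c(3)[of l] pos[of l] c(1) a_pos[of l] by (simp add: powr_minus field_simps)
    show "1 / a l \<le> c2 * (1 + lb_eigenvalue d l) powr s"
      using c(4)[of l] pos[of l] c(1) a_pos[of l] by (simp add: powr_minus field_simps)
  qed (use c in auto)
qed

text \<open>
  The terms are of the order \<open>(l + d) powr (d - 1 - 2 * s)\<close>, and the exponent is less than \<open>- 1\<close>
  exactly because \<open>s > d / 2\<close>.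
\<close>

lemma summable_trace: "summable (\<lambda>l. a l * real (Z l))"
proof -
  obtain c1 where c1: "c1 > 0" "\<And>l. c1 * a l \<le> (1 + lb_eigenvalue d l) powr (- s)"
    using weight_bounds by metis
  have s0: "s > 0" using s dim(2) by linarith
  define C where "C = 1 / c1 * (4 * (real d)\<^sup>2) powr s * 2"
  have bound: "norm (a l * real (Z l)) \<le> C * real (l + d) powr (real d - 1 - 2 * s)" for l
  proof -
    have ld: "real l + real d > 0" using dim(2) by simp
    have d0: "4 * (real d)\<^sup>2 > 0" using dim(2) by simp
    have lam: "1 + lb_eigenvalue d l > 0" using lb_eigenvalue_nonneg[of d l] dim by simp
    have "((real l + real d)\<^sup>2) powr s \<le> (4 * (real d)\<^sup>2 * (1 + lb_eigenvalue d l)) powr s"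
      using lb_eigenvalue_ge[OF dim(2), of l] s0 by (intro powr_mono2) auto
    also have "\<dots> = (4 * (real d)\<^sup>2) powr s * (1 + lb_eigenvalue d l) powr s"
      using d0 lam by (simp add: powr_mult)
    also have "((real l + real d)\<^sup>2) powr s = (real l + real d) powr (2 * s)"
      using powr_powr[of "real l + real d" 2 s] powr_numeral[OF less_imp_le[OF ld], of "num.Bit0 num.One"] by simp
    finally have "(1 + lb_eigenvalue d l) powr (- s) \<le> (4 * (real d)\<^sup>2) powr s * (real l + real d) powr (- (2 * s))"
      using lam ld by (simp add: powr_minus field_simps)
    then have "c1 * a l \<le> (4 * (real d)\<^sup>2) powr s * (real l + real d) powr (- (2 * s))"
      using c1(2)[of l] by linarith
    then have 1: "a l \<le> 1 / c1 * ((4 * (real d)\<^sup>2) powr s * (real l + real d) powr (- (2 * s)))"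
      using c1(1) by (simp add: field_simps)
    have "real (Z l) \<le> real (2 * (l + d) ^ (d - 1))"
      using harmonic_dim_le[OF dim(2), of l] by (simp only: of_nat_le_iff)
    also have "\<dots> = 2 * (real l + real d) powr (real d - 1)"
      using powr_realpow[OF ld, of "d - 1"] dim(2) by (simp add: of_nat_diff)
    finally have 2: "real (Z l) \<le> 2 * (real l + real d) powr (real d - 1)" .
    have "a l * real (Z l) \<le> (1 / c1 * ((4 * (real d)\<^sup>2) powr s * (real l + real d) powr (- (2 * s)))) *
        (2 * (real l + real d) powr (real d - 1))"
      using 1 2 c1(1) by (intro mult_mono) auto
    also have "\<dots> = C * ((real l + real d) powr (- (2 * s)) * (real l + real d) powr (real d - 1))"
      by (simp add: C_def mult_ac)
    also have "(real l + real d) powr (- (2 * s)) * (real l + real d) powr (real d - 1) =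
        real (l + d) powr (real d - 1 - 2 * s)"
      using powr_add[of "real l + real d" "- (2 * s)" "real d - 1"] by (simp add: algebra_simps)
    finally show ?thesis using a_pos[of l] by simp
  qed
  have "summable (\<lambda>l. real (l + d) powr (real d - 1 - 2 * s))"
    using s by (subst summable_iff_shift[of "\<lambda>l. real l powr (real d - 1 - 2 * s)"]) (simp add: summable_real_powr_iff)
  then have "summable (\<lambda>l. C * real (l + d) powr (real d - 1 - 2 * s))" by (rule summable_mult)
  then show ?thesis by (rule summable_comparison_test') (rule bound)
qed

lemma summable_sobolev_iff:
  fixes c :: "nat \<Rightarrow> nat \<Rightarrow> real"
  shows "summable (\<lambda>l. \<Sum>k=1..Z l. (1 + lb_eigenvalue d l) powr s * \<bar>c l k\<bar>\<^sup>2) \<longleftrightarrow>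
         summable (\<lambda>l. \<Sum>k=1..Z l. 1 / a l * \<bar>c l k\<bar>\<^sup>2)"
proof -
  obtain c1 c2 where c: "c1 > 0" "c2 > 0"
    "\<And>l. (1 + lb_eigenvalue d l) powr s \<le> 1 / c1 * (1 / a l)"
    "\<And>l. 1 / a l \<le> c2 * (1 + lb_eigenvalue d l) powr s"
    using weight_bounds by metis
  let ?S = "\<lambda>l. \<Sum>k=1..Z l. \<bar>c l k\<bar>\<^sup>2"
  have comp: "summable (\<lambda>l. u l * ?S l)"
    if v: "summable (\<lambda>l. v l * ?S l)" and uv: "\<And>l. 0 \<le> u l" "\<And>l. u l \<le> C * v l" for u v :: "nat \<Rightarrow> real" and C
  proof (rule summable_comparison_test'[of "\<lambda>l. C * (v l * ?S l)" 0])
    show "summable (\<lambda>l. C * (v l * ?S l))" using v by (rule summable_mult)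
    fix l
    have "u l * ?S l \<le> C * v l * ?S l" by (intro mult_right_mono uv sum_nonneg) simp
    moreover have "0 \<le> u l * ?S l" by (intro mult_nonneg_nonneg uv sum_nonneg) simp
    ultimately show "norm (u l * ?S l) \<le> C * (v l * ?S l)" by (simp add: mult.assoc)
  qed
  show ?thesis
    unfolding sum_distrib_left[symmetric]
    using comp[of "\<lambda>l. 1 / a l" "\<lambda>l. (1 + lb_eigenvalue d l) powr s" "1 / c1"]
      comp[of "\<lambda>l. (1 + lb_eigenvalue d l) powr s" "\<lambda>l. 1 / a l" c2] c a_pos
    by (auto simp: less_imp_le)
qed

section \<open>Harmonic series in the Sobolev space\<close>

lemma abs_Y_le:
  assumes "norm x = 1" "k \<in> {1..Z l}" shows "\<bar>Y l k x\<bar> \<le> 1 + real (Z l)"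
proof -
  have "(Y l k x)\<^sup>2 \<le> (\<Sum>k=1..Z l. (Y l k x)\<^sup>2)" using assms by (intro member_le_sum) auto
  also have "\<dots> = real (Z l)" by (rule addition_formula[OF assms(1)])
  finally have "\<bar>Y l k x\<bar>\<^sup>2 \<le> real (Z l)" by simp
  moreover have "2 * \<bar>Y l k x\<bar> \<le> 1 + \<bar>Y l k x\<bar>\<^sup>2"
    using zero_le_power2[of "\<bar>Y l k x\<bar> - 1"] unfolding power2_diff by simp
  ultimately show ?thesis using of_nat_0_le_iff[of "Z l"] by linarith
qed

text \<open>
  A majorant for the terms of a harmonic series, from the inequality between the arithmetic and
  the geometric mean and from \<open>addition_formula\<close>. It does not depend on the point, and its two
  parts are summable for coefficients of finite norm and by \<open>summable_trace\<close>.
\<close>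

definition term_bound :: "(nat \<Rightarrow> nat \<Rightarrow> real) \<Rightarrow> nat \<Rightarrow> real" where
  "term_bound c l = ((\<Sum>k=1..Z l. 1 / a l * \<bar>c l k\<bar>\<^sup>2) + a l * real (Z l)) / 2"

lemma abs_harmonic_term_le:
  assumes "norm x = 1"
  shows "\<bar>\<Sum>k=1..Z l. c l k * Y l k x\<bar> \<le> term_bound c l"
proof -
  have le: "\<bar>c l k * Y l k x\<bar> \<le> (1 / a l * \<bar>c l k\<bar>\<^sup>2 + a l * (Y l k x)\<^sup>2) / 2" for k
  proof -
    have r: "sqrt (a l) > 0" "(sqrt (a l))\<^sup>2 = a l" using a_pos[of l] by simp_all
    have "0 \<le> (\<bar>c l k\<bar> / sqrt (a l) - sqrt (a l) * \<bar>Y l k x\<bar>)\<^sup>2" by simp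
    also have "\<dots> = 1 / a l * \<bar>c l k\<bar>\<^sup>2 + a l * (Y l k x)\<^sup>2 - 2 * \<bar>c l k * Y l k x\<bar>"
      unfolding power2_diff using r by (simp add: power_divide power_mult_distrib abs_mult)
    finally show ?thesis by simp
  qed
  have "\<bar>\<Sum>k=1..Z l. c l k * Y l k x\<bar> \<le> (\<Sum>k=1..Z l. \<bar>c l k * Y l k x\<bar>)" by (rule sum_abs)
  also have "\<dots> \<le> (\<Sum>k=1..Z l. (1 / a l * \<bar>c l k\<bar>\<^sup>2 + a l * (Y l k x)\<^sup>2) / 2)"
    by (intro sum_mono le)
  also have "\<dots> = ((\<Sum>k=1..Z l. 1 / a l * \<bar>c l k\<bar>\<^sup>2) + a l * (\<Sum>k=1..Z l. (Y l k x)\<^sup>2)) / 2"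
    by (simp add: sum_divide_distrib[symmetric] sum.distrib sum_distrib_left)
  also have "\<dots> = term_bound c l" by (simp only: term_bound_def addition_formula[OF assms])
  finally show ?thesis .
qed

definition harmonic_series :: "(nat \<Rightarrow> nat \<Rightarrow> real) \<Rightarrow> real ^ 'n \<Rightarrow> real" where
  "harmonic_series c x = (\<Sum>l. \<Sum>k=1..Z l. c l k * Y l k x)"

context
  fixes c :: "nat \<Rightarrow> nat \<Rightarrow> real"
  assumes c: "summable (\<lambda>l. \<Sum>k=1..Z l. 1 / a l * \<bar>c l k\<bar>\<^sup>2)"
begin

lemma summable_term_bound: "summable (term_bound c)"
  unfolding term_bound_def[abs_def] by (intro summable_divide summable_add c summable_trace)

lemma summable_harmonic_series:
  assumes "norm x = 1"
  shows "summable (\<lambda>l. \<Sum>k=1..Z l. c l k * Y l k x)"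
  using summable_term_bound
  by (rule summable_comparison_test') (simp only: real_norm_def abs_harmonic_term_le[OF assms])

lemma continuous_harmonic_series: "continuous_on (sphere 0 1) (harmonic_series c)"
proof (rule uniform_limit_theorem)
  show "uniform_limit (sphere 0 1) (\<lambda>n x. \<Sum>l<n. \<Sum>k=1..Z l. c l k * Y l k x) (harmonic_series c) sequentially"
    unfolding harmonic_series_def[abs_def]
    by (rule Weierstrass_m_test[OF _ summable_term_bound]) (simp only: real_norm_def, rule abs_harmonic_term_le, simp)
  show "eventually (\<lambda>n. continuous_on (sphere 0 1) (\<lambda>x. \<Sum>l<n. \<Sum>k=1..Z l. c l k * Y l k x)) sequentially"
    by (intro always_eventually allI continuous_on_sum continuous_on_mult continuous_on_const continuous_Y)
qed simp

lemma fourier_coeff_harmonic_series: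
  assumes k: "k \<in> {1..Z l}"
  shows "fourier_coeff Y (harmonic_series c) l k = c l k"
proof -
  interpret prob_space "sphere_measure :: (real ^ 'n) measure" by (rule prob_space_sphere_measure)
  let ?B = "1 + real (Z l)"
  define g where "g j x = (\<Sum>i=1..Z j. c j i * Y j i x) * Y l k x" for j x
  have bound: "norm (g j x) \<le> term_bound c j * ?B" if "norm x = 1" for j x
    unfolding g_def real_norm_def abs_mult
    using abs_harmonic_term_le[OF that, of c j] abs_Y_le[OF that k] by (intro mult_mono) auto
  have sB: "summable (\<lambda>j. term_bound c j * ?B)" by (intro summable_mult2 summable_term_bound)
  have cont: "continuous_on (sphere 0 1) (g j)" for j
    unfolding g_def using k
    by (intro continuous_on_sum continuous_on_mult continuous_on_const continuous_Y)
  have int: "integrable sphere_measure (g j)" for j by (rule integrable_sphere_measure[OF cont])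
  have int_g: "(LINT x|sphere_measure. g j x) = (if j = l then c l k else 0)" for j
  proof -
    have "(LINT x|sphere_measure. g j x) = (\<Sum>i=1..Z j. c j i * (LINT x|sphere_measure. Y j i x * Y l k x))"
      unfolding g_def by (intro integral_sphere_sum_mult continuous_Y k)
    also have "\<dots> = (\<Sum>i=1..Z j. if i = k \<and> j = l then c l k else 0)"
      using k by (intro sum.cong) (auto simp: orthonormal_Y)
    also have "\<dots> = (if j = l then c l k else 0)" using k by (cases "j = l") auto
    finally show ?thesis .
  qed
  have "fourier_coeff Y (harmonic_series c) l k = (LINT x|sphere_measure. (\<Sum>j. g j x))"
    unfolding fourier_coeff_def
  proof (rule Bochner_Integration.integral_cong[OF refl])
    fix x :: "real ^ 'n" assume "x \<in> space sphere_measure"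
    then have "norm x = 1" by simp
    then show "harmonic_series c x * Y l k x = (\<Sum>j. g j x)"
      unfolding harmonic_series_def g_def by (intro suminf_mult2 summable_harmonic_series)
  qed
  also have "\<dots> = (\<Sum>j. LINT x|sphere_measure. g j x)"
  proof (rule integral_suminf[OF int])
    show "AE x in sphere_measure. summable (\<lambda>j. norm (g j x))"
    proof (rule AE_I2)
      fix x :: "real ^ 'n" assume "x \<in> space sphere_measure"
      then have x: "norm x = 1" by simp
      show "summable (\<lambda>j. norm (g j x))"
        using sB by (rule summable_comparison_test') (use bound[OF x] in simp)
    qed
    show "summable (\<lambda>j. LINT x|sphere_measure. norm (g j x))"
      using sB
    proof (rule summable_comparison_test')
      fix j
      have "(LINT x|sphere_measure. norm (g j x)) \<le> (LINT x|(sphere_measure :: (real ^ 'n) measure). term_bound c j * ?B)"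
        using bound by (intro integral_mono integrable_norm int) auto
      then show "norm (LINT x|sphere_measure. norm (g j x)) \<le> term_bound c j * ?B"
        using prob_space by simp
    qed
  qed
  also have "\<dots> = (\<Sum>j. if j = l then c l k else 0)" by (simp only: int_g)
  also have "\<dots> = c l k"
    using suminf_finite[of "{l}" "\<lambda>j. if j = l then c l k else 0"] by simp
  finally show ?thesis .
qed

lemma sobolev_harmonic_series: "harmonic_series c \<in> sobolev_space d s Y"
proof -
  have eq: "(\<Sum>k=1..Z l. (1 + lb_eigenvalue d l) powr s * \<bar>fourier_coeff Y (harmonic_series c) l k\<bar>\<^sup>2) =
      (\<Sum>k=1..Z l. (1 + lb_eigenvalue d l) powr s * \<bar>c l k\<bar>\<^sup>2)" for l
    by (intro sum.cong refl) (simp only: fourier_coeff_harmonic_series)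
  have "integrable sphere_measure (\<lambda>x. (harmonic_series c x)\<^sup>2)"
    by (intro integrable_sphere_measure continuous_on_power continuous_harmonic_series)
  moreover have "summable (\<lambda>l. \<Sum>k=1..Z l. (1 + lb_eigenvalue d l) powr s *
      \<bar>fourier_coeff Y (harmonic_series c) l k\<bar>\<^sup>2)"
    unfolding eq using c by (simp only: summable_sobolev_iff)
  ultimately show ?thesis
    using continuous_harmonic_series measurable_sphere_measure[OF continuous_harmonic_series]
    unfolding sobolev_space_def sphere_L2_def by (simp only: mem_Collect_eq simp_thms)
qed

lemma norm_harmonic_series:
  "sobolev_norm d a Y (harmonic_series c) = sqrt (\<Sum>l. \<Sum>k=1..Z l. 1 / a l * \<bar>c l k\<bar>\<^sup>2)"
proof -
  have "(\<Sum>k=1..Z l. 1 / a l * \<bar>fourier_coeff Y (harmonic_series c) l k\<bar>\<^sup>2) =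
      (\<Sum>k=1..Z l. 1 / a l * \<bar>c l k\<bar>\<^sup>2)" for l
    by (intro sum.cong refl) (simp only: fourier_coeff_harmonic_series)
  then show ?thesis by (simp only: sobolev_norm_def)
qed

end

lemma sobolev_summable:
  assumes "f \<in> sobolev_space d s Y"
  shows "summable (\<lambda>l. \<Sum>k=1..Z l. 1 / a l * \<bar>fourier_coeff Y f l k\<bar>\<^sup>2)"
  using assms unfolding sobolev_space_def by (simp only: mem_Collect_eq summable_sobolev_iff)

text \<open>
  The function and its harmonic series are continuous and have the same coefficients.
\<close>

lemma sobolev_expansion:
  assumes f: "f \<in> sobolev_space d s Y" and x: "norm x = 1"
  shows "f x = harmonic_series (fourier_coeff Y f) x"
proof -
  have cf: "continuous_on (sphere 0 1) f" using f by (simp add: sobolev_space_def)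
  let ?g = "harmonic_series (fourier_coeff Y f)"
  note sm = sobolev_summable[OF f]
  note cg = continuous_harmonic_series[OF sm]
  have "f x - ?g x = 0"
  proof (rule completeness[OF _ _ x])
    show "continuous_on (sphere 0 1) (\<lambda>x. f x - ?g x)" by (intro continuous_on_diff cf cg)
    fix l k assume k: "k \<in> {1..Z l}"
    have "(LINT x|sphere_measure. (f x - ?g x) * Y l k x) = fourier_coeff Y f l k - fourier_coeff Y ?g l k"
      unfolding fourier_coeff_def left_diff_distrib
      by (intro Bochner_Integration.integral_diff integrable_sphere_measure continuous_on_mult cf continuous_Y k
          cg[unfolded fourier_coeff_def])
    then show "(LINT x|sphere_measure. (f x - ?g x) * Y l k x) = 0"
      by (simp only: fourier_coeff_harmonic_series[OF sm k] diff_self)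
  qed
  then show ?thesis by simp
qed

section \<open>The worst-case error\<close>

lemma Z_0: "Z 0 = 1" by (rule harmonic_dim_0[OF dim(2)])

lemma Y_0_const: "\<exists>c0. c0\<^sup>2 = 1 \<and> (\<forall>x. norm x = 1 \<longrightarrow> Y 0 1 x = c0)"
proof -
  have 1: "1 \<in> {1..Z 0}" by (simp add: Z_0)
  obtain p where p: "p \<in> hom_polys 0" "\<forall>x. laplacian p x = 0" "\<forall>x\<in>sphere 0 1. Y 0 1 x = p x"
    by (rule harmonic_extension[OF 1])
  have "p x = p 0" for x using hom_polys_scaleR[OF p(1), of 0 x] by simp
  then have Yc: "Y 0 1 x = p 0" if "norm x = 1" for x using p(3) that by simp
  obtain x0 :: "real ^ 'n" where x0: "norm x0 = 1" using vector_choose_size[of 1] by auto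
  have "(p 0)\<^sup>2 = 1" using addition_formula[OF x0, of 0] Yc[OF x0] by (simp add: Z_0)
  with Yc show ?thesis by blast
qed

text \<open>
  Harmonics of positive degree are orthogonal to \<open>Y 0 1\<close>, which is a nonzero constant.
\<close>

lemma integral_Y:
  assumes "l \<noteq> 0" "k \<in> {1..Z l}" shows "(LINT x|sphere_measure. Y l k x) = 0"
proof -
  obtain c0 where c0: "c0\<^sup>2 = 1" "\<forall>x. norm x = 1 \<longrightarrow> Y 0 1 x = c0" using Y_0_const by blast
  have "c0 * (LINT x|sphere_measure. Y l k x) = (LINT x|sphere_measure. c0 * Y l k x)" by simp
  also have "\<dots> = (LINT x|sphere_measure. Y 0 1 x * Y l k x)"
    by (rule Bochner_Integration.integral_cong) (simp_all add: c0 del: One_nat_def)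
  also have "\<dots> = 0" using assms by (subst orthonormal_Y) (auto simp: Z_0)
  finally show ?thesis using c0(1) by auto
qed

text \<open>
  The harmonic of degree \<open>0\<close> is the constant \<open>1\<close> or \<open>- 1\<close>, and its sign cancels in the product.
\<close>

lemma integral_eq_term_0:
  assumes "norm x = 1"
  shows "(LINT y|sphere_measure. f y) = (\<Sum>k=1..Z 0. fourier_coeff Y f 0 k * Y 0 k x)"
proof -
  obtain c0 where c0: "c0\<^sup>2 = 1" "\<forall>x. norm x = 1 \<longrightarrow> Y 0 1 x = c0" using Y_0_const by blast
  have "fourier_coeff Y f 0 1 = (LINT y|sphere_measure. f y * c0)"
    unfolding fourier_coeff_def by (rule Bochner_Integration.integral_cong) (simp_all add: c0 del: One_nat_def)
  then show ?thesis using c0 assms by (simp add: Z_0 power2_eq_square mult.assoc)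
qed

definition node_mean :: "nat \<Rightarrow> (nat \<Rightarrow> real ^ 'n) \<Rightarrow> nat \<Rightarrow> nat \<Rightarrow> real" where
  "node_mean N x l k = 1 / real N * (\<Sum>j=1..N. Y l k (x j))"

text \<open>
  The square of the error in the dual norm, written with the kernel
  \<open>\<Sum>l\<ge>1. a l * (\<Sum>k. Y l k x * Y l k y)\<close>: the average of this kernel over all pairs of nodes.
\<close>

definition kernel_error :: "nat \<Rightarrow> (nat \<Rightarrow> real ^ 'n) \<Rightarrow> real" where
  "kernel_error N x = (\<Sum>l. a (Suc l) * (\<Sum>k=1..Z (Suc l). (node_mean N x (Suc l) k)\<^sup>2))"

context
  fixes N :: nat and x :: "nat \<Rightarrow> real ^ 'n"
  assumes N: "N \<ge> 1" and x: "\<And>j. j \<in> {1..N} \<Longrightarrow> norm (x j) = 1"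
begin

lemma sum_node_mean_le: "(\<Sum>k=1..Z l. (node_mean N x l k)\<^sup>2) \<le> real (Z l)"
proof -
  have "(node_mean N x l k)\<^sup>2 \<le> 1 / real N * (\<Sum>j=1..N. (Y l k (x j))\<^sup>2)" for k
  proof -
    have "(node_mean N x l k)\<^sup>2 \<le> (1 / real N)\<^sup>2 * ((\<Sum>j=1..N. (Y l k (x j))\<^sup>2) * real N)"
      unfolding node_mean_def power_mult_distrib
      using sum_squared_le_sum_of_squares[of "\<lambda>j. Y l k (x j)" "{1..N}"]
      by (intro mult_left_mono) simp_all
    then show ?thesis using N by (simp add: power2_eq_square)
  qed
  then have "(\<Sum>k=1..Z l. (node_mean N x l k)\<^sup>2) \<le> (\<Sum>k=1..Z l. 1 / real N * (\<Sum>j=1..N. (Y l k (x j))\<^sup>2))"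
    by (intro sum_mono)
  also have "\<dots> = 1 / real N * (\<Sum>j=1..N. \<Sum>k=1..Z l. (Y l k (x j))\<^sup>2)"
    unfolding sum_distrib_left[symmetric] by (subst sum.swap) (rule refl)
  also have "(\<Sum>j=1..N. \<Sum>k=1..Z l. (Y l k (x j))\<^sup>2) = (\<Sum>j=1..N. real (Z l))"
    by (rule sum.cong[OF refl]) (rule addition_formula[OF x])
  also have "1 / real N * (\<Sum>j=1..N. real (Z l)) = real (Z l)" using N by simp
  finally show ?thesis .
qed

lemma summable_kernel_error: "summable (\<lambda>l. a l * (\<Sum>k=1..Z l. (node_mean N x l k)\<^sup>2))"
  using summable_trace
proof (rule summable_comparison_test')
  fix l
  have "a l * (\<Sum>k=1..Z l. (node_mean N x l k)\<^sup>2) \<le> a l * real (Z l)"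
    using a_pos[of l] by (intro mult_left_mono sum_node_mean_le) simp
  moreover have "0 \<le> a l * (\<Sum>k=1..Z l. (node_mean N x l k)\<^sup>2)"
    using a_pos[of l] by (intro mult_nonneg_nonneg sum_nonneg) simp_all
  ultimately show "norm (a l * (\<Sum>k=1..Z l. (node_mean N x l k)\<^sup>2)) \<le> a l * real (Z l)" by simp
qed

lemma summable_kernel_error_Suc:
  "summable (\<lambda>l. a (Suc l) * (\<Sum>k=1..Z (Suc l). (node_mean N x (Suc l) k)\<^sup>2))"
  using iffD2[OF summable_Suc_iff summable_kernel_error] .

lemma kernel_error_nonneg: "kernel_error N x \<ge> 0"
  unfolding kernel_error_def
  by (intro suminf_nonneg summable_kernel_error_Suc mult_nonneg_nonneg sum_nonneg) (simp_all add: a_pos less_imp_le)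

lemma error_expansion:
  assumes f: "f \<in> sobolev_space d s Y"
  shows "(\<lambda>l. \<Sum>k=1..Z (Suc l). fourier_coeff Y f (Suc l) k * node_mean N x (Suc l) k) sums
         (1 / real N * (\<Sum>j=1..N. f (x j)) - (LINT y|sphere_measure. f y))"
proof -
  note sm = sobolev_summable[OF f]
  let ?u = "\<lambda>l z. \<Sum>k=1..Z l. fourier_coeff Y f l k * Y l k z"
  have "(\<lambda>l. ?u (Suc l) (x j)) sums (f (x j) - (LINT y|sphere_measure. f y))" if j: "j \<in> {1..N}" for j
  proof -
    have "(\<lambda>l. ?u l (x j)) sums f (x j)"
      using summable_sums[OF summable_harmonic_series[OF sm x[OF j]]]
      by (simp only: sobolev_expansion[OF f x[OF j]] harmonic_series_def)
    then have "(\<lambda>l. ?u (Suc l) (x j)) sums (f (x j) - ?u 0 (x j))" 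
      by (intro iffD2[OF sums_Suc_iff[of "\<lambda>l. ?u l (x j)" "f (x j) - ?u 0 (x j)"]]) (simp only: diff_add_cancel)
    then show ?thesis by (simp only: integral_eq_term_0[OF x[OF j]])
  qed
  then have "(\<lambda>l. \<Sum>j=1..N. ?u (Suc l) (x j)) sums (\<Sum>j=1..N. f (x j) - (LINT y|sphere_measure. f y))"
    by (rule sums_sum)
  then have "(\<lambda>l. 1 / real N * (\<Sum>j=1..N. ?u (Suc l) (x j))) sums
      (1 / real N * (\<Sum>j=1..N. f (x j) - (LINT y|sphere_measure. f y)))"
    by (rule sums_mult)
  moreover have "1 / real N * (\<Sum>j=1..N. f (x j) - (LINT y|sphere_measure. f y)) =
      1 / real N * (\<Sum>j=1..N. f (x j)) - (LINT y|sphere_measure. f y)"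
    using N by (simp add: sum_subtractf right_diff_distrib)
  moreover have "1 / real N * (\<Sum>j=1..N. ?u l (x j)) =
      (\<Sum>k=1..Z l. fourier_coeff Y f l k * node_mean N x l k)" for l
    unfolding node_mean_def sum_distrib_left by (subst sum.swap) (simp add: mult_ac)
  ultimately show ?thesis by simp
qed

text \<open>
  Cauchy-Schwarz for the finite partial sums of \<open>error_expansion\<close>, with the factors \<open>c / sqrt a\<close>
  and \<open>m * sqrt a\<close>; the limit preserves the inequality.
\<close>

lemma error_le_kernel_error:
  assumes f: "f \<in> sobolev_space d s Y" "sobolev_norm d a Y f \<le> 1"
  shows "\<bar>1 / real N * (\<Sum>j=1..N. f (x j)) - (LINT y|sphere_measure. f y)\<bar>\<^sup>2 \<le> kernel_error N x"
proof -
  let ?c = "fourier_coeff Y f" and ?m = "node_mean N x"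
  let ?A = "\<lambda>l. \<Sum>k=1..Z l. 1 / a l * \<bar>?c l k\<bar>\<^sup>2"
  let ?B = "\<lambda>l. a l * (\<Sum>k=1..Z l. (?m l k)\<^sup>2)"
  let ?E = "1 / real N * (\<Sum>j=1..N. f (x j)) - (LINT y|sphere_measure. f y)"
  note sm = sobolev_summable[OF f(1)]
  have A0: "?A l \<ge> 0" for l by (intro sum_nonneg mult_nonneg_nonneg) (simp_all add: a_pos less_imp_le)
  have B0: "?B l \<ge> 0" for l by (intro mult_nonneg_nonneg sum_nonneg) (simp_all add: a_pos less_imp_le)
  have norm: "(\<Sum>l. ?A l) \<le> 1"
    using f(2) by (simp add: sobolev_norm_def)
  have part: "(\<Sum>l<n. \<Sum>k=1..Z (Suc l). ?c (Suc l) k * ?m (Suc l) k)\<^sup>2 \<le> kernel_error N x" for n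
  proof -
    let ?I = "SIGMA l:{..<n}. {1..Z (Suc l)}"
    let ?r = "\<lambda>i. sqrt (a (Suc (fst i)))"
    let ?p = "\<lambda>i. ?c (Suc (fst i)) (snd i) / ?r i" and ?q = "\<lambda>i. ?m (Suc (fst i)) (snd i) * ?r i"
    have r: "?r i > 0" "(?r i)\<^sup>2 = a (Suc (fst i))" for i using a_pos[of "Suc (fst i)"] by simp_all
    have "(\<Sum>l<n. \<Sum>k=1..Z (Suc l). ?c (Suc l) k * ?m (Suc l) k) = (\<Sum>i\<in>?I. ?p i * ?q i)"
      using r by (subst sum.Sigma) (auto simp: case_prod_unfold less_imp_neq[THEN not_sym] intro!: sum.cong)
    then have "(\<Sum>l<n. \<Sum>k=1..Z (Suc l). ?c (Suc l) k * ?m (Suc l) k)\<^sup>2 \<le> (\<Sum>i\<in>?I. (?p i)\<^sup>2) * (\<Sum>i\<in>?I. (?q i)\<^sup>2)"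
      by (simp only: Cauchy_Schwarz_ineq_sum)
    also have "(\<Sum>i\<in>?I. (?p i)\<^sup>2) = (\<Sum>l<n. ?A (Suc l))"
      by (subst sum.Sigma) (auto simp: case_prod_unfold power_divide r intro!: sum.cong)
    also have "(\<Sum>i\<in>?I. (?q i)\<^sup>2) = (\<Sum>l<n. ?B (Suc l))"
      unfolding sum_distrib_left
      by (subst sum.Sigma) (auto simp: case_prod_unfold power_mult_distrib r mult.commute intro!: sum.cong)
    also have "(\<Sum>l<n. ?A (Suc l)) * (\<Sum>l<n. ?B (Suc l)) \<le> 1 * kernel_error N x"
    proof (rule mult_mono)
      have "(\<Sum>l<n. ?A (Suc l)) \<le> (\<Sum>l<Suc n. ?A l)"
        unfolding sum.lessThan_Suc_shift using A0[of 0] by simp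
      also have "\<dots> \<le> (\<Sum>l. ?A l)" using A0 by (intro sum_le_suminf[OF sm]) auto
      finally show "(\<Sum>l<n. ?A (Suc l)) \<le> 1" using norm by linarith
      show "(\<Sum>l<n. ?B (Suc l)) \<le> kernel_error N x"
        unfolding kernel_error_def using B0 by (intro sum_le_suminf[OF summable_kernel_error_Suc]) auto
    qed (use B0 in \<open>auto intro!: sum_nonneg\<close>)
    finally show ?thesis by simp
  qed
  have "(\<lambda>n. \<Sum>l<n. \<Sum>k=1..Z (Suc l). ?c (Suc l) k * ?m (Suc l) k) \<longlonglongrightarrow> ?E"
    using error_expansion[OF f(1)] by (simp only: sums_def)
  then have "(\<lambda>n. (\<Sum>l<n. \<Sum>k=1..Z (Suc l). ?c (Suc l) k * ?m (Suc l) k)\<^sup>2) \<longlonglongrightarrow> ?E\<^sup>2"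
    by (rule tendsto_power)
  then have "?E\<^sup>2 \<le> kernel_error N x"
    by (rule LIMSEQ_le_const2) (intro exI allI impI part)
  then show ?thesis by simp
qed

text \<open>
  Equality in Cauchy-Schwarz: the extremal function has coefficients proportional to
  \<open>a l * node_mean N x l k\<close> in the degrees \<open>l \<ge> 1\<close>.
\<close>

lemma kernel_error_attained:
  obtains f where "f \<in> sobolev_space d s Y" "sobolev_norm d a Y f \<le> 1"
    "\<bar>1 / real N * (\<Sum>j=1..N. f (x j)) - (LINT y|sphere_measure. f y)\<bar>\<^sup>2 = kernel_error N x"
proof -
  let ?m = "node_mean N x" and ?T = "kernel_error N x"
  let ?B = "\<lambda>l. a l * (\<Sum>k=1..Z l. (?m l k)\<^sup>2)"
  \<comment> \<open>if the kernel error is \<open>0\<close>, division by zero makes all coefficients \<open>0\<close>, and the zero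
    function is extremal\<close>
  define c where "c l k = (if l = 0 then 0 else a l * ?m l k / sqrt ?T)" for l k
  have T0: "?T \<ge> 0" by (rule kernel_error_nonneg)
  have BT: "(\<lambda>l. ?B (Suc l)) sums ?T"
    unfolding kernel_error_def using summable_kernel_error_Suc by (rule summable_sums)
  have A: "(\<Sum>k=1..Z l. 1 / a l * \<bar>c l k\<bar>\<^sup>2) = (if l = 0 then 0 else ?B l / ?T)" for l
  proof (cases "l = 0")
    case False
    have "1 / a l * \<bar>c l k\<bar>\<^sup>2 = a l * (?m l k)\<^sup>2 / ?T" for k
      using a_pos[of l] T0 False by (simp add: c_def power_divide power_mult_distrib power2_eq_square)
    then show ?thesis using False by (simp add: sum_distrib_left sum_divide_distrib)
  qed (simp add: c_def)
  have "(\<lambda>l. \<Sum>k=1..Z (Suc l). 1 / a (Suc l) * \<bar>c (Suc l) k\<bar>\<^sup>2) sums (?T / ?T)"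
    unfolding A using sums_divide[OF BT, of ?T] by simp
  then have A_sums: "(\<lambda>l. \<Sum>k=1..Z l. 1 / a l * \<bar>c l k\<bar>\<^sup>2) sums (?T / ?T)"
    using sums_Suc[of "\<lambda>l. \<Sum>k=1..Z l. 1 / a l * \<bar>c l k\<bar>\<^sup>2" "?T / ?T"] A[of 0] by simp
  then have sm: "summable (\<lambda>l. \<Sum>k=1..Z l. 1 / a l * \<bar>c l k\<bar>\<^sup>2)" by (rule sums_summable)
  let ?f = "harmonic_series c"
  have f: "?f \<in> sobolev_space d s Y" by (rule sobolev_harmonic_series[OF sm])
  have nf: "sobolev_norm d a Y ?f \<le> 1"
    unfolding norm_harmonic_series[OF sm] sums_unique[OF A_sums, symmetric] by simp
  have "(\<Sum>k=1..Z (Suc l). fourier_coeff Y ?f (Suc l) k * ?m (Suc l) k) = ?B (Suc l) / sqrt ?T" for l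
  proof -
    have "(\<Sum>k=1..Z (Suc l). fourier_coeff Y ?f (Suc l) k * ?m (Suc l) k) =
        (\<Sum>k=1..Z (Suc l). a (Suc l) * (?m (Suc l) k)\<^sup>2 / sqrt ?T)"
      by (intro sum.cong refl) (simp add: fourier_coeff_harmonic_series[OF sm] c_def power2_eq_square)
    then show ?thesis by (simp add: sum_distrib_left sum_divide_distrib)
  qed
  then have "(\<lambda>l. ?B (Suc l) / sqrt ?T) sums (1 / real N * (\<Sum>j=1..N. ?f (x j)) - (LINT y|sphere_measure. ?f y))"
    using error_expansion[OF f] by simp
  moreover have "(\<lambda>l. ?B (Suc l) / sqrt ?T) sums (?T / sqrt ?T)" by (rule sums_divide[OF BT])
  ultimately have "1 / real N * (\<Sum>j=1..N. ?f (x j)) - (LINT y|sphere_measure. ?f y) = ?T / sqrt ?T"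
    by (rule sums_unique2)
  also have "\<dots> = sqrt ?T" using T0 by (rule real_div_sqrt)
  finally have err: "1 / real N * (\<Sum>j=1..N. ?f (x j)) - (LINT y|sphere_measure. ?f y) = sqrt ?T" .
  have "\<bar>1 / real N * (\<Sum>j=1..N. ?f (x j)) - (LINT y|sphere_measure. ?f y)\<bar>\<^sup>2 = ?T"
    unfolding err using T0 by simp
  with f nf show ?thesis by (rule that)
qed

lemma sup_sq_error_eq: "sup_sq_error d s a Y N x = kernel_error N x"
proof -
  obtain f where f: "f \<in> sobolev_space d s Y" "sobolev_norm d a Y f \<le> 1"
    "\<bar>1 / real N * (\<Sum>j=1..N. f (x j)) - (LINT y|sphere_measure. f y)\<bar>\<^sup>2 = kernel_error N x"
    by (rule kernel_error_attained)
  show ?thesis unfolding sup_sq_error_def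
  proof (rule cSup_eq_maximum)
    show "kernel_error N x \<in> (\<lambda>f. \<bar>1 / real N * (\<Sum>j=1..N. f (x j)) - (LINT y|sphere_measure. f y)\<bar>\<^sup>2) `
        {f \<in> sobolev_space d s Y. sobolev_norm d a Y f \<le> 1}"
      by (rule image_eqI[where x = f]) (simp_all only: f mem_Collect_eq simp_thms)
  qed (use error_le_kernel_error in blast)
qed

end

section \<open>Expectation over independent nodes\<close>

context
  fixes M :: "'p measure" and X :: "nat \<Rightarrow> 'p \<Rightarrow> real ^ 'n" and N :: nat
  assumes N: "N \<ge> 1" and M: "prob_space M"
    and indep: "prob_space.indep_vars M (\<lambda>_. sphere_measure) X {1..N}"
    and law: "\<And>j. j \<in> {1..N} \<Longrightarrow> distr M sphere_measure (X j) = sphere_measure"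
begin

lemma node_measurable: "j \<in> {1..N} \<Longrightarrow> X j \<in> measurable M sphere_measure"
  using indep unfolding prob_space.indep_vars_def[OF M] by blast

lemma node_norm:
  assumes "\<omega> \<in> space M" "j \<in> {1..N}" shows "norm (X j \<omega>) = 1"
  using measurable_space[OF node_measurable[OF assms(2)] assms(1)] by simp

lemma node_integral:
  fixes g :: "real ^ 'n \<Rightarrow> real"
  assumes g: "continuous_on (sphere 0 1) g" and j: "j \<in> {1..N}"
  shows "integrable M (\<lambda>\<omega>. g (X j \<omega>))" "(LINT \<omega>|M. g (X j \<omega>)) = (LINT y|sphere_measure. g y)"
proof -
  note gm = measurable_sphere_measure[OF g] and Xm = node_measurable[OF j]
  have "integrable (distr M sphere_measure (X j)) g"
    unfolding law[OF j] by (rule integrable_sphere_measure[OF g])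
  then show "integrable M (\<lambda>\<omega>. g (X j \<omega>))" by (simp only: integrable_distr_eq[OF Xm gm])
  show "(LINT \<omega>|M. g (X j \<omega>)) = (LINT y|sphere_measure. g y)"
    using integral_distr[OF Xm gm] by (simp only: law[OF j])
qed

text \<open>
  For different nodes the expectation factors by independence, and both factors are integrals of
  a harmonic of positive degree.
\<close>

lemma node_correlation:
  assumes l: "l \<noteq> 0" and k: "k \<in> {1..Z l}" and ij: "i \<in> {1..N}" "j \<in> {1..N}"
  shows "integrable M (\<lambda>\<omega>. Y l k (X i \<omega>) * Y l k (X j \<omega>))"
    and "(LINT \<omega>|M. Y l k (X i \<omega>) * Y l k (X j \<omega>)) = (if i = j then 1 else 0)"
proof -
  note cY = continuous_Y[OF k]
  have "integrable M (\<lambda>\<omega>. Y l k (X i \<omega>) * Y l k (X j \<omega>)) \<and>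
    (LINT \<omega>|M. Y l k (X i \<omega>) * Y l k (X j \<omega>)) = (if i = j then 1 else 0)"
  proof (cases "i = j")
    case True
    note node_integral[OF continuous_on_mult[OF cY cY] ij(2)]
    then show ?thesis using True orthonormal_Y[OF k k] by simp
  next
    case False
    have "prob_space.indep_vars M (\<lambda>_. sphere_measure) X {i, j}"
      by (rule prob_space.indep_vars_subset[OF M indep]) (use ij in simp)
    then have ind: "prob_space.indep_vars M (\<lambda>_. borel) (\<lambda>i \<omega>. Y l k (X i \<omega>)) {i, j}"
      by (rule prob_space.indep_vars_compose2[OF M]) (rule measurable_sphere_measure[OF cY])
    have int: "integrable M (\<lambda>\<omega>. Y l k (X i' \<omega>))" if "i' \<in> {i, j}" for i'
      by (rule node_integral(1)[OF cY]) (use that ij in auto)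
    have fin: "finite {i, j}" by simp
    have "(LINT \<omega>|M. (\<Prod>i'\<in>{i, j}. Y l k (X i' \<omega>))) = (\<Prod>i'\<in>{i, j}. LINT \<omega>|M. Y l k (X i' \<omega>))"
      by (rule prob_space.indep_vars_lebesgue_integral[OF M fin ind int])
    moreover have "integrable M (\<lambda>\<omega>. (\<Prod>i'\<in>{i, j}. Y l k (X i' \<omega>)))"
      by (rule prob_space.indep_vars_integrable[OF M fin ind int])
    moreover have "(LINT \<omega>|M. Y l k (X i \<omega>)) = 0"
      unfolding node_integral(2)[OF cY ij(1)] by (rule integral_Y[OF l k])
    ultimately show ?thesis using False by simp
  qed
  then show "integrable M (\<lambda>\<omega>. Y l k (X i \<omega>) * Y l k (X j \<omega>))"
    "(LINT \<omega>|M. Y l k (X i \<omega>) * Y l k (X j \<omega>)) = (if i = j then 1 else 0)" by blast+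
qed

lemma node_mean_variance:
  assumes l: "l \<noteq> 0" and k: "k \<in> {1..Z l}"
  shows "integrable M (\<lambda>\<omega>. (node_mean N (\<lambda>j. X j \<omega>) l k)\<^sup>2)"
    and "(LINT \<omega>|M. (node_mean N (\<lambda>j. X j \<omega>) l k)\<^sup>2) = 1 / real N"
proof -
  have eq: "(node_mean N (\<lambda>j. X j \<omega>) l k)\<^sup>2 =
      (1 / real N)\<^sup>2 * (\<Sum>i=1..N. \<Sum>j=1..N. Y l k (X i \<omega>) * Y l k (X j \<omega>))" for \<omega>
    unfolding node_mean_def power_mult_distrib by (simp only: power2_eq_square sum_product)
  note int = node_correlation(1)[OF l k]
  show "integrable M (\<lambda>\<omega>. (node_mean N (\<lambda>j. X j \<omega>) l k)\<^sup>2)"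
    unfolding eq by (intro integrable_mult_right Bochner_Integration.integrable_sum int)
  have "(LINT \<omega>|M. (\<Sum>i=1..N. \<Sum>j=1..N. Y l k (X i \<omega>) * Y l k (X j \<omega>))) =
      (\<Sum>i=1..N. LINT \<omega>|M. (\<Sum>j=1..N. Y l k (X i \<omega>) * Y l k (X j \<omega>)))"
    by (intro Bochner_Integration.integral_sum Bochner_Integration.integrable_sum int)
  also have "\<dots> = (\<Sum>i=1..N. \<Sum>j=1..N. LINT \<omega>|M. Y l k (X i \<omega>) * Y l k (X j \<omega>))"
    by (intro sum.cong refl Bochner_Integration.integral_sum int)
  also have "\<dots> = (\<Sum>i=1..N. \<Sum>j=1..N. if i = j then 1 else 0)"
    by (intro sum.cong refl node_correlation(2)[OF l k])
  also have "\<dots> = real N" by simp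
  finally have "(LINT \<omega>|M. (\<Sum>i=1..N. \<Sum>j=1..N. Y l k (X i \<omega>) * Y l k (X j \<omega>))) = real N" .
  then show "(LINT \<omega>|M. (node_mean N (\<lambda>j. X j \<omega>) l k)\<^sup>2) = 1 / real N"
    unfolding eq using N by (simp add: power2_eq_square)
qed

text \<open>
  The expectation of the kernel error is computed term by term; the terms are nonnegative and
  their expectations are summable by \<open>summable_trace\<close>.
\<close>

lemma expectation_sup_sq_error:
  "(LINT \<omega>|M. sup_sq_error d s a Y N (\<lambda>j. X j \<omega>)) = (\<Sum>l. a (Suc l) * real (Z (Suc l))) / real N"
proof -
  interpret prob_space M by (rule M)
  define g where "g l \<omega> = a (Suc l) * (\<Sum>k=1..Z (Suc l). (node_mean N (\<lambda>j. X j \<omega>) (Suc l) k)\<^sup>2)" for l \<omega>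
  have g0: "g l \<omega> \<ge> 0" for l \<omega>
    unfolding g_def by (intro mult_nonneg_nonneg sum_nonneg) (simp_all add: a_pos less_imp_le)
  have gint: "integrable M (g l)" for l
    unfolding g_def[abs_def] by (intro integrable_mult_right Bochner_Integration.integrable_sum node_mean_variance(1)) simp_all
  have gexp: "(LINT \<omega>|M. g l \<omega>) = a (Suc l) * real (Z (Suc l)) / real N" for l
  proof -
    have "(LINT \<omega>|M. g l \<omega>) = a (Suc l) * (LINT \<omega>|M. (\<Sum>k=1..Z (Suc l). (node_mean N (\<lambda>j. X j \<omega>) (Suc l) k)\<^sup>2))"
      unfolding g_def by simp
    also have "(LINT \<omega>|M. (\<Sum>k=1..Z (Suc l). (node_mean N (\<lambda>j. X j \<omega>) (Suc l) k)\<^sup>2)) =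
        (\<Sum>k=1..Z (Suc l). LINT \<omega>|M. (node_mean N (\<lambda>j. X j \<omega>) (Suc l) k)\<^sup>2)"
      by (intro Bochner_Integration.integral_sum node_mean_variance(1)) simp_all
    also have "\<dots> = (\<Sum>k=1..Z (Suc l). 1 / real N)"
      by (intro sum.cong refl node_mean_variance(2)) simp_all
    finally show ?thesis by simp
  qed
  have sum_b: "summable (\<lambda>l. a (Suc l) * real (Z (Suc l)))"
    using iffD2[OF summable_Suc_iff summable_trace] .
  have "(LINT \<omega>|M. sup_sq_error d s a Y N (\<lambda>j. X j \<omega>)) = (LINT \<omega>|M. (\<Sum>l. g l \<omega>))"
  proof (rule Bochner_Integration.integral_cong[OF refl])
    fix \<omega> assume w: "\<omega> \<in> space M"
    have "sup_sq_error d s a Y N (\<lambda>j. X j \<omega>) = kernel_error N (\<lambda>j. X j \<omega>)"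
      by (rule sup_sq_error_eq[OF N]) (rule node_norm[OF w])
    then show "sup_sq_error d s a Y N (\<lambda>j. X j \<omega>) = (\<Sum>l. g l \<omega>)"
      by (simp only: kernel_error_def g_def)
  qed
  also have "\<dots> = (\<Sum>l. LINT \<omega>|M. g l \<omega>)"
  proof (rule integral_suminf[OF gint])
    show "AE \<omega> in M. summable (\<lambda>l. norm (g l \<omega>))"
    proof (rule AE_I2)
      fix \<omega> assume w: "\<omega> \<in> space M"
      have "summable (\<lambda>l. g l \<omega>)"
        unfolding g_def by (rule summable_kernel_error_Suc[OF N]) (rule node_norm[OF w])
      then show "summable (\<lambda>l. norm (g l \<omega>))" using g0 by simp
    qed
    have "(LINT \<omega>|M. norm (g l \<omega>)) = a (Suc l) * real (Z (Suc l)) / real N" for l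
      using gexp[of l] g0 by simp
    then show "summable (\<lambda>l. LINT \<omega>|M. norm (g l \<omega>))"
      using summable_divide[OF sum_b, of "real N"] by simp
  qed
  also have "\<dots> = (\<Sum>l. a (Suc l) * real (Z (Suc l))) / real N"
    unfolding gexp by (rule suminf_divide[OF sum_b])
  finally show ?thesis .
qed

end

lemma trace_pos: "(\<Sum>l. a (Suc l) * real (Z (Suc l))) > 0"
  by (rule suminf_pos[OF iffD2[OF summable_Suc_iff summable_trace]])
     (simp add: a_pos harmonic_dim_pos[OF dim(2)])

end

text \<open>
  The joint law of the coordinate projections is the product measure itself.
\<close>

lemma indep_vars_projections:
  assumes P: "\<And>i. i \<in> I \<Longrightarrow> prob_space (P i)" and I: "I \<noteq> {}"
  shows "prob_space.indep_vars (PiM I P) P (\<lambda>i \<omega>. \<omega> i) I"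
proof -
  have "distr (PiM I P) (PiM I P) (\<lambda>\<omega>. \<lambda>i\<in>I. \<omega> i) = distr (PiM I P) (PiM I P) (\<lambda>\<omega>. \<omega>)"
    by (rule distr_cong) (auto simp: space_PiM)
  also have "\<dots> = (\<Pi>\<^sub>M i\<in>I. distr (PiM I P) (P i) (\<lambda>\<omega>. \<omega> i))"
    by (simp only: distr_id2) (rule PiM_cong, rule refl, rule distr_PiM_component[symmetric], rule P)
  finally show ?thesis
    by (subst prob_space.indep_vars_iff_distr_eq_PiM'[OF prob_space_PiM I]) (auto intro: P)
qed

theorem theorem7:
  fixes d :: nat and s :: real
    and a :: "nat \<Rightarrow> real"
    and Y :: "nat \<Rightarrow> nat \<Rightarrow> real ^ 'n \<Rightarrow> real"
  assumes dim: "CARD('n) = d + 1" "d \<ge> 2"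
    and s: "s > real d / 2"
    and Y: "orthonormal_harmonics d Y"
    and a_pos: "\<And>l. a l > 0"
    and a_asymp: "same_order a (\<lambda>l. (1 + lb_eigenvalue d l) powr (- s))"
  shows "\<exists>b>0. \<forall>N\<ge>1.
           sqrt (LINT x|(\<Pi>\<^sub>M j\<in>{1..N}. sphere_measure). sup_sq_error d s a Y N x)
             = b / sqrt (real N) \<and>
           (\<forall>(M :: 'p measure) X.
              prob_space M \<longrightarrow>
              prob_space.indep_vars M (\<lambda>_. sphere_measure) X {1..N} \<longrightarrow>
              (\<forall>j\<in>{1..N}. distr M sphere_measure (X j) = sphere_measure) \<longrightarrow>
              sqrt (LINT \<omega>|M. sup_sq_error d s a Y N (\<lambda>j. X j \<omega>))
                = b / sqrt (real N))"
proof -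
  interpret sobolev_kernel d Y s a
    by unfold_locales (fact dim Y s a_pos a_asymp)+
  \<comment> \<open>\<open>b\<^sup>2\<close> is the trace of the kernel; degree \<open>0\<close> is missing because constants are integrated
    exactly\<close>
  define b where "b = sqrt (\<Sum>l. a (Suc l) * real (harmonic_dim d (Suc l)))"
  have "b > 0" unfolding b_def using trace_pos by simp
  moreover have "sqrt (LINT x|(\<Pi>\<^sub>M j\<in>{1..N}. sphere_measure). sup_sq_error d s a Y N x) = b / sqrt (real N)"
    if N: "N \<ge> 1" for N
  proof -
    let ?P = "\<Pi>\<^sub>M j\<in>{1..N}. (sphere_measure :: (real ^ 'n) measure)"
    have P: "prob_space ?P" by (rule prob_space_PiM) (rule prob_space_sphere_measure)
    have "prob_space.indep_vars ?P (\<lambda>_. sphere_measure) (\<lambda>i \<omega>. \<omega> i) {1..N}"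
      by (rule indep_vars_projections) (use N prob_space_sphere_measure in auto)
    moreover have "distr ?P sphere_measure (\<lambda>\<omega>. \<omega> j) = sphere_measure" if "j \<in> {1..N}" for j
      by (rule distr_PiM_component[OF prob_space_sphere_measure that])
    ultimately have "(LINT x|?P. sup_sq_error d s a Y N (\<lambda>j. x j)) =
        (\<Sum>l. a (Suc l) * real (harmonic_dim d (Suc l))) / real N"
      by (rule expectation_sup_sq_error[OF N P])
    then show ?thesis by (simp only: b_def real_sqrt_divide)
  qed
  moreover have "sqrt (LINT \<omega>|M. sup_sq_error d s a Y N (\<lambda>j. X j \<omega>)) = b / sqrt (real N)"
    if "N \<ge> 1" "prob_space M" "prob_space.indep_vars M (\<lambda>_. sphere_measure) X {1..N}"
      "\<forall>j\<in>{1..N}. distr M sphere_measure (X j) = sphere_measure" for N and M :: "'p measure" and X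
    using expectation_sup_sq_error[OF that(1-3)] that(4) by (simp only: b_def real_sqrt_divide)
  ultimately show ?thesis by blast
qed

end
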